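(* For a full-dimensional convex polytope $P$ in $\mathbb{R}^n$, Warren's adjoint polynomial $\mathrm{adj}_P$ vanishes along the residual arrangement $\mathcal{R}_{P^\ast}$ of the dual polytope $P^\ast$. In particular, if the hyperplane arrangement $\mathcal{H}_{P^\ast}$ is simple, the zero locus of the adjoint polynomial $\mathrm{adj}_P$ is the adjoint hypersurface $A_{P^\ast}$.
   Context: For $v\in\mathbb{R}^n$ let $\ell_v(t):=1-v_1t_1-\cdots-v_nt_n$, and let $V(\cdot)$ denote the set of vertices. Warren's adjoint polynomial of a convex polytope $P$ is $$\mathrm{adj}_P(t):=\sum_{\sigma\in\tau(P)}\mathrm{vol}(\sigma)\prod_{v\in V(P)\setminus V(\sigma)}\ell_v(t),$$ where $\tau(P)$ is any triangulation of $P$ into $n$-simplices whose vertices are vertices of $P$ (the polynomial does not depend on the triangulation). Polytopes are considered in complex projective space $\mathbb{P}^n$: a polytope in $\mathbb{P}^n$ is the collection of Zariski closures of the (nonempty) faces of a polytope that is convex in some real affine chart. The dual polytope $P^\ast$ is the polytope in $\mathbb{P}^n$ given by the projectivization of the dual cone $\{(t_0,t)\in\mathbb{R}^{n+1}: t_0-v_1t_1-\cdots-v_nt_n\ge 0 \text{ for all } v\in V(P)\}$; when the origin is in the interior of $P$ this is the usual dual $\{t\in\mathbb{R}^n:\ell_v(t)\ge 0\text{ for all }v\in V(P)\}$. Thus the facet hyperplanes of $P^\ast$ are the zero sets of the forms $t_0-v_1t_1-\cdots-v_nt_n$ for $v\in V(P)$, and the face of $P^\ast$ corresponding to a proper nonempty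 face $G$ of $P$ spans the common zero set of these forms for $v\in V(G)$. For a full-dimensional polytope $Q$ in $\mathbb{P}^n$, $\mathcal{H}_Q$ is the arrangement of hyperplanes spanned by the facets of $Q$; it is simple if through any point of $\mathbb{P}^n$ pass at most $n$ of its hyperplanes. The residual arrangement $\mathcal{R}_Q$ consists of all linear spaces that are intersections of hyperplanes in $\mathcal{H}_Q$ and do not contain any face of $Q$. If $Q$ has $d$ facets and $\mathcal{H}_Q$ is simple, the adjoint hypersurface $A_Q$ is the unique hypersurface in $\mathbb{P}^n$ of degree $d-n-1$ vanishing along $\mathcal{R}_Q$. Vanishing and zero loci of $\mathrm{adj}_P$ in $\mathbb{P}^n$ are understood for its homogenization to degree $|V(P)|-n-1$ (each $\ell_v$ being replaced by $t_0-v_1t_1-\cdots-v_nt_n$). *)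

theory Defs
  imports "HOL-Analysis.Analysis"
begin

text \<open>
  Points of complex projective space are written in homogeneous coordinates: a subset of it is
  represented by the set of all nonzero coordinate vectors of its points. With
  coordinates indexed by a type \<open>'m\<close>, the projective dimension is \<open>CARD('m) - 1\<close>; for the
  projective space containing affine \<open>'n\<close>-space we take \<open>'m = 'n option\<close>, the index \<open>None\<close>
  belonging to the homogenizing coordinate \<open>t\<^sub>0\<close>. The empty projective set is \<open>{}\<close>, not \<open>{0}\<close>.
\<close>

definition homogeneous_poly :: "nat \<Rightarrow> (complex ^ 'm \<Rightarrow> complex) \<Rightarrow> bool" where
  "homogeneous_poly k f \<longleftrightarrow>
     (\<exists>c :: ('m \<Rightarrow> nat) \<Rightarrow> complex. \<forall>x.
        f x = (\<Sum>\<alpha> | (\<Sum>i\<in>UNIV. \<alpha> i) = k. c \<alpha> * (\<Prod>i\<in>UNIV. (x $ i) ^ \<alpha> i)))"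

definition zero_locus :: "(complex ^ 'm \<Rightarrow> complex) \<Rightarrow> (complex ^ 'm) set" where
  "zero_locus f = {x. x \<noteq> 0 \<and> f x = 0}"

definition zariski_closure :: "(complex ^ 'm) set \<Rightarrow> (complex ^ 'm) set" where
  "zariski_closure S =
     {x. x \<noteq> 0 \<and> (\<forall>k f. homogeneous_poly k f \<and> S \<subseteq> zero_locus f \<longrightarrow> f x = 0)}"

text \<open>A degree 0 hypersurface is empty.\<close>

definition hypersurface :: "nat \<Rightarrow> (complex ^ 'm) set \<Rightarrow> bool" where
  "hypersurface k X \<longleftrightarrow>
     (\<exists>f. homogeneous_poly k f \<and> (\<exists>x. f x \<noteq> 0) \<and> X = zero_locus f)"

text \<open>
  A polytope in projective space is given by a real polyhedral cone \<open>C\<close> over it. The face \<open>{0}\<close> of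
  the cone corresponds to the empty face of the polytope.
\<close>

definition complexify :: "real ^ 'm \<Rightarrow> complex ^ 'm" where
  "complexify y = (\<chi> i. complex_of_real (y $ i))"

definition proj_closure :: "(real ^ 'm) set \<Rightarrow> (complex ^ 'm) set" where
  "proj_closure F = zariski_closure (complexify ` (F - {0}))"

definition proj_faces :: "(real ^ 'm) set \<Rightarrow> (complex ^ 'm) set set" where
  "proj_faces C = {proj_closure F | F. F face_of C \<and> F \<noteq> {} \<and> F \<noteq> {0}}"

definition facet_arrangement :: "(real ^ 'm) set \<Rightarrow> (complex ^ 'm) set set" where
  "facet_arrangement C = {vec.span (proj_closure F) - {0} | F. F facet_of C}"

definition simple_arrangement :: "(complex ^ 'm) set set \<Rightarrow> bool" where
  "simple_arrangement \<H> \<longleftrightarrow> (\<forall>x. x \<noteq> 0 \<longrightarrow> card {H \<in> \<H>. x \<in> H} \<le> CARD('m) - 1)"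

definition residual_arrangement :: "(real ^ 'm) set \<Rightarrow> (complex ^ 'm) set set" where
  "residual_arrangement C =
     {\<Inter>\<S> | \<S>. \<S> \<subseteq> facet_arrangement C \<and> (\<forall>F \<in> proj_faces C. \<not> F \<subseteq> \<Inter>\<S>)}"

text \<open>
  In projective dimension \<open>n = CARD('m) - 1\<close> the degree \<open>d - n - 1\<close> is \<open>d - CARD('m)\<close>.
  Hypersurfaces are compared as point sets. This loses nothing: if two non-proportional forms
  of this degree vanished along the residual arrangement, some member of their pencil would
  have a different zero locus.
\<close>

definition is_adjoint_hypersurface :: "(real ^ 'm) set \<Rightarrow> (complex ^ 'm) set \<Rightarrow> bool" where
  "is_adjoint_hypersurface C A \<longleftrightarrow>
     (let candidate = (\<lambda>X. hypersurface (card {F. F facet_of C} - CARD('m)) X \<and>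
                           (\<forall>L \<in> residual_arrangement C. L \<subseteq> X))
      in candidate A \<and> (\<forall>X. candidate X \<longrightarrow> X = A))"

definition vertices :: "(real ^ 'n) set \<Rightarrow> (real ^ 'n) set" where
  "vertices P = {v. v extreme_point_of P}"

definition vertex_triangulation :: "(real ^ 'n) set \<Rightarrow> (real ^ 'n) set set \<Rightarrow> bool" where
  "vertex_triangulation P \<T> \<longleftrightarrow>
     triangulation \<T> \<and> \<Union>\<T> = P \<and>
     (\<forall>\<sigma>\<in>\<T>. int CARD('n) simplex \<sigma> \<and> vertices \<sigma> \<subseteq> vertices P)"

definition ell :: "real ^ 'n \<Rightarrow> 'a :: {real_algebra_1, comm_ring_1} ^ 'n \<Rightarrow> 'a" where
  "ell v t = 1 - (\<Sum>i\<in>UNIV. of_real (v $ i) * t $ i)"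

definition ell_hom :: "real ^ 'n \<Rightarrow> 'a :: {real_algebra_1, comm_ring_1} ^ ('n option) \<Rightarrow> 'a" where
  "ell_hom v x = x $ None - (\<Sum>i\<in>UNIV. of_real (v $ i) * x $ Some i)"

definition warren_adjoint ::
  "(real ^ 'n) set \<Rightarrow> (real ^ 'n) set set \<Rightarrow> 'a :: {real_algebra_1, comm_ring_1} ^ 'n \<Rightarrow> 'a" where
  "warren_adjoint P \<T> t =
     (\<Sum>\<sigma>\<in>\<T>. of_real (measure lebesgue \<sigma>) * (\<Prod>v \<in> vertices P - vertices \<sigma>. ell v t))"

text \<open>
  The homogenization: each summand is a product of \<open>card (vertices P) - CARD('n) - 1\<close> linear
  forms, so this is the homogenization to that degree.
\<close>

definition warren_adjoint_hom ::
  "(real ^ 'n) set \<Rightarrow> (real ^ 'n) set set \<Rightarrow> complex ^ ('n option) \<Rightarrow> complex" where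
  "warren_adjoint_hom P \<T> x =
     (\<Sum>\<sigma>\<in>\<T>. of_real (measure lebesgue \<sigma>) * (\<Prod>v \<in> vertices P - vertices \<sigma>. ell_hom v x))"

lemma warren_adjoint_hom_affine:
  "warren_adjoint_hom P \<T> (\<chi> j. case j of None \<Rightarrow> 1 | Some i \<Rightarrow> t $ i) = warren_adjoint P \<T> t"
  by (simp add: warren_adjoint_hom_def warren_adjoint_def ell_hom_def ell_def)

definition dual_cone :: "(real ^ 'n) set \<Rightarrow> (real ^ ('n option)) set" where
  "dual_cone P = {y. \<forall>v \<in> vertices P. ell_hom v y \<ge> 0}"

end

theory Submission
  imports Defs
begin

text \<open>
  Vanishing. Let \<open>x\<close> be a nonzero point and choose an affine point \<open>a\<close> with \<open>\<ell>\<^sub>a(x) \<noteq> 0\<close>. On every simplex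
  \<open>\<sigma>\<close> of the triangulation write \<open>a = \<Sum> c\<^bsub>\<sigma>,v\<^esub> v\<close> in barycentric coordinates; then
  \<open>\<ell>\<^sub>a(x) = \<Sum> c\<^bsub>\<sigma>,v\<^esub> \<ell>\<^sub>v(x)\<close>, so that \<open>\<ell>\<^sub>a(x) adj(x)\<close> is the sum over all pairs \<open>(\<sigma>, v)\<close> of
  \<open>vol(\<sigma>) c\<^bsub>\<sigma>,v\<^esub>\<close> times the product of \<open>\<ell>\<^sub>u(x)\<close> over all vertices \<open>u\<close> of \<open>P\<close> outside the wall
  \<open>\<rho> = V(\<sigma>) - {v}\<close>. If \<open>D\<close> is the affine function given by the determinant with the wall \<open>\<rho>\<close>, then
  \<open>vol(\<sigma>) = |D(v)| / n!\<close> and \<open>c\<^bsub>\<sigma>,v\<^esub> = D(a) / D(v)\<close>. Hence the term of \<open>(\<sigma>, v)\<close> depends only on \<open>\<rho>\<close>,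
  up to the sign that tells on which side of \<open>\<rho>\<close> the vertex \<open>v\<close> lies. A wall inside \<open>P\<close> has exactly one
  simplex on each side, and the two terms cancel (\<open>wall_signs_cancel\<close>). A wall in a facet of \<open>P\<close> contributes
  zero when \<open>x\<close> lies on the residual arrangement: the vertices \<open>u\<close> with \<open>\<ell>\<^sub>u(x) = 0\<close> do not lie in one
  proper face of \<open>P\<close>, so one of them is outside \<open>\<rho>\<close> and its form occurs in the product.

  Uniqueness. Let \<open>d\<close> be the number of vertices, and suppose that any \<open>n + 1\<close> of the forms \<open>\<ell>\<^sub>v\<close> are
  linearly independent. Let \<open>f\<close> be a form of degree \<open>d - n - 1\<close> vanishing on the residual arrangement.
  A form of this degree that vanishes on all but at most one of the hyperplane sections of a
  linear space \<open>{\<ell>\<^sub>v = 0, v \<in> J}\<close> of positive dimension vanishes on that space, because a generic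
  line in it meets more than \<open>d - n - 1\<close> of the sections (\<open>vanishes_on_from_hyperplane_sections\<close>).
  On the line spanned by an edge of the dual polytope, every intersection point with the other hyperplanes
  except the two ends of the edge is residual; so if \<open>f\<close> vanishes at one end, it vanishes at the other.
  The edge graph is connected, by the simplex method: from any vertex, an edge decreasing the
  sum of the forms that are zero at a target vertex leads closer to it (\<open>vanishes_on_all_vertices\<close>).
  Therefore \<open>f\<close> is zero as soon as it vanishes at one vertex, so any two such forms are
  proportional. The adjoint polynomial is one of them and is not zero, since at the
  origin of affine space it is the volume of \<open>P\<close>.
\<close>

section \<open>The linear form of a point\<close>

text \<open>
  For fixed \<open>x\<close> the value \<open>\<ell>\<^sub>v(x)\<close> is an affine function of \<open>v\<close>. This is used at complex \<open>x\<close>, and also at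
  real \<open>x\<close>, which then serves as the coefficient vector of an arbitrary real affine function of \<open>v\<close>.
\<close>

lemma ell_hom_affine_combination:
  fixes x :: "'a :: {real_algebra_1, comm_ring_1} ^ (('n::finite) option)"
  assumes "finite S" "sum c S = 1"
  shows "ell_hom (\<Sum>r\<in>S. c r *\<^sub>R r) x = (\<Sum>r\<in>S. of_real (c r) * ell_hom r x)"
proof -
  have "(\<Sum>i\<in>UNIV. of_real ((\<Sum>r\<in>S. c r *\<^sub>R r) $ i) * x $ Some i)
      = (\<Sum>r\<in>S. of_real (c r) * (\<Sum>i\<in>UNIV. of_real (r $ i) * x $ Some i))"
    by (simp add: sum_distrib_left sum_distrib_right mult.assoc)
       (subst sum.swap, simp)
  moreover have "(\<Sum>r\<in>S. of_real (c r) * x $ None) = x $ None"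
    by (metis assms(2) mult_1 of_real_1 of_real_sum sum_distrib_right)
  ultimately show ?thesis
    by (simp add: ell_hom_def right_diff_distrib sum_subtractf)
qed

lemma ell_hom_segment:
  fixes x :: "'a :: {real_algebra_1, comm_ring_1} ^ (('n::finite) option)"
  shows "ell_hom ((1 - t) *\<^sub>R p + t *\<^sub>R q) x = of_real (1 - t) * ell_hom p x + of_real t * ell_hom q x"
  by (simp add: ell_hom_def sum_distrib_left sum.distrib sum_subtractf algebra_simps)

lemma ell_hom_right_linear:
  "ell_hom v (x + y) = ell_hom v x + ell_hom v y"
  "ell_hom v (x - y) = ell_hom v x - ell_hom v y"
  "ell_hom v (c *s x) = c * ell_hom v x"
  "ell_hom v 0 = 0"
  "ell_hom v (- x) = - ell_hom v x"
  by (simp_all add: ell_hom_def sum.distrib sum_subtractf sum_distrib_left algebra_simps sum_negf)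

lemma ell_hom_scaleR: "ell_hom v (c *\<^sub>R x :: real ^ ('n::finite) option) = c * ell_hom v x"
  by (simp add: ell_hom_def sum_distrib_left algebra_simps)

section \<open>Volumes of simplices over a common wall\<close>

text \<open>
  The determinant formula for the volume of a simplex refers to coordinates in a fixed well-order.
  This is a well-ordered copy of the index type; volumes do not change under relabelling
  of the coordinates.
\<close>

typedef ('n::finite) coord = "{..<CARD('n)}"
  by (rule exI[of _ 0]) simp

instance coord :: (finite) finite
proof
  show "finite (UNIV :: 'a coord set)"
    by (metis finite_imageI finite_lessThan type_definition.Abs_image type_definition_coord)
qed

instantiation coord :: (finite) wellorder
begin
definition "x \<le> y \<longleftrightarrow> Rep_coord x \<le> Rep_coord y"
definition "x < y \<longleftrightarrow> Rep_coord x < Rep_coord y"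
instance
proof
  fix P :: "'a coord \<Rightarrow> bool" and a
  assume *: "\<And>x. (\<And>y. y < x \<Longrightarrow> P y) \<Longrightarrow> P x"
  show "P a"
    by (induction "Rep_coord a" arbitrary: a rule: less_induct) (metis * less_coord_def)
qed (auto simp: less_eq_coord_def less_coord_def Rep_coord_inject)
end

lemma card_coord: "CARD('n::finite coord) = CARD('n)"
  by (metis card_lessThan type_definition.card type_definition_coord)

definition reindex :: "('m \<Rightarrow> 'n) \<Rightarrow> real ^ 'n \<Rightarrow> real ^ 'm" where
  "reindex \<pi> x = (\<chi> j. x $ \<pi> j)"

lemma linear_reindex: "linear (reindex \<pi>)"
  by (intro linearI) (simp_all add: reindex_def vec_eq_iff)

lemma prod_Basis_cart: "(\<Prod>b\<in>Basis. w \<bullet> b) = (\<Prod>i\<in>UNIV. w $ i)" for w :: "real ^ 'n"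
proof -
  have "(Basis :: (real ^ 'n) set) = range (\<lambda>i. axis i 1)"
    by (auto simp: Basis_vec_def)
  then have "(\<Prod>b\<in>Basis. w \<bullet> b) = (\<Prod>b\<in>range (\<lambda>i. axis i 1). w \<bullet> b)"
    by (rule arg_cong)
  also have "\<dots> = (\<Prod>i\<in>UNIV. w \<bullet> axis i 1)"
    by (subst prod.reindex) (auto simp: inj_on_def axis_eq_axis)
  finally show ?thesis
    by (simp add: inner_axis)
qed

lemma measure_reindex:
  fixes \<pi> :: "'m::finite \<Rightarrow> 'n::finite"
  assumes "bij \<pi>" "compact A"
  shows "measure lebesgue (reindex \<pi> ` A) = measure lebesgue A"
proof -
  define R where "R = reindex \<pi>"
  have inj: "inj R" 
  proof (rule injI)
    fix x y assume "R x = R y"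
    then have "\<forall>j. x $ \<pi> j = y $ \<pi> j"
      by (simp add: R_def reindex_def vec_eq_iff)
    then show "x = y"
      using assms(1) by (metis bij_pointE vec_eq_iff)
  qed
  have cont: "continuous_on UNIV R"
    by (simp add: R_def linear_continuous_on linear_linear linear_reindex)
  have [measurable]: "R \<in> borel \<rightarrow>\<^sub>M borel"
    using cont by (rule borel_measurable_continuous_onI)
  have RA: "R ` A \<in> sets borel"
    by (rule borel_compact, rule compact_continuous_image) (use cont assms(2) continuous_on_subset in auto)
  have "lborel = distr lborel borel R"
  proof (rule lborel_eqI)
    fix l u :: "real ^ 'm"
    assume le: "\<And>b. b \<in> Basis \<Longrightarrow> l \<bullet> b \<le> u \<bullet> b"
    define S where "S = (reindex (inv \<pi>) :: real ^ 'm \<Rightarrow> real ^ 'n)"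
    have vim: "R -` box l u = box (S l) (S u)"
      using assms(1)
      apply (auto simp: R_def S_def reindex_def mem_box_cart)
      apply (metis bij_inv_eq_iff)+
      done
    have "emeasure lborel (box (S l) (S u)) = (\<Prod>b\<in>Basis. (S u - S l) \<bullet> b)"
    proof (rule emeasure_lborel_box)
      fix b :: "real ^ 'n" assume "b \<in> Basis"
      then obtain i where "b = axis i 1" by (auto simp: Basis_vec_def)
      then show "S l \<bullet> b \<le> S u \<bullet> b"
        using le[of "axis (inv \<pi> i) 1"] 
        by (simp add: S_def reindex_def inner_axis axis_in_Basis_iff)
    qed
    also have "(\<Prod>b\<in>Basis. (S u - S l) \<bullet> b) = (\<Prod>b\<in>Basis. (u - l) \<bullet> b)"
    proof -
      have "(\<Prod>b\<in>Basis. (S u - S l) \<bullet> b) = (\<Prod>i\<in>UNIV. (S u - S l) $ i)"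
        by (rule prod_Basis_cart)
      also have "\<dots> = (\<Prod>i\<in>UNIV. (u - l) $ inv \<pi> i)"
        by (simp add: S_def reindex_def)
      also have "\<dots> = (\<Prod>j\<in>UNIV. (u - l) $ j)"
        by (rule prod.reindex_bij_betw) (use assms(1) bij_imp_bij_inv in blast)
      also have "\<dots> = (\<Prod>b\<in>Basis. (u - l) \<bullet> b)"
        by (rule prod_Basis_cart[symmetric])
      finally show ?thesis .
    qed
    finally show "emeasure (distr lborel borel R) (box l u) = (\<Prod>b\<in>Basis. (u - l) \<bullet> b)"
      by (simp add: emeasure_distr vim)
  qed simp
  then have "emeasure lborel (R ` A) = emeasure (distr lborel borel R) (R ` A)" by simp
  also have "\<dots> = emeasure lborel (R -` (R ` A))"
    using RA by (subst emeasure_distr) auto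
  also have "R -` (R ` A) = A"
    using inj by (simp add: inj_vimage_image_eq)
  finally have "measure lborel (R ` A) = measure lborel A"
    by (simp add: measure_def)
  moreover have "A \<in> sets borel"
    using assms(2) by (rule borel_compact)
  ultimately show ?thesis
    using RA by (simp add: R_def)
qed

text \<open>
  Replacing one column of the determinant of a simplex by a variable gives an affine function of the apex
  over the wall \<open>\<rho>\<close>. It is recorded as the vector \<open>y\<close> of its coefficients, so that its value at \<open>v\<close> is
  \<open>ell_hom v y\<close>. It vanishes identically when \<open>\<rho>\<close> is affinely dependent.
\<close>

lemma simplex_wall_form_wellorder:
  fixes \<rho> :: "(real ^ 'n::{finite,wellorder}) set"
  assumes "finite \<rho>" "card \<rho> = CARD('n)"
  obtains y :: "real ^ 'n option" where
    "\<And>r. r \<in> \<rho> \<Longrightarrow> ell_hom r y = 0"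
    "\<And>v. v \<notin> \<rho> \<Longrightarrow> measure lebesgue (convex hull (insert v \<rho>)) = \<bar>ell_hom v y\<bar> / fact CARD('n)"
proof -
  obtain x0 where x0: "x0 \<in> \<rho>"
    using assms(2) by (metis card_eq_0_iff ex_in_conv zero_less_card_finite less_not_refl)
  obtain k :: 'n where True by simp
  have "card (UNIV - {k}) = card (\<rho> - {x0})"
    using assms x0 by simp
  then obtain f where f: "bij_betw f (UNIV - {k}) (\<rho> - {x0})"
    using finite_same_card_bij[of "UNIV - {k}" "\<rho> - {x0}"] assms(1) by auto
  \<comment> \<open>Column \<open>k\<close> is reserved for the apex; the other columns are the edges of the wall at \<open>x0\<close>.\<close>
  define A where "A w = (\<chi> i j. if j = k then w $ i else f j $ i - x0 $ i)" for w
  define g where "g w = det (A w)" for w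
  have gT: "g w = det (\<chi> j. if j = k then w else f j - x0)" for w
    unfolding g_def A_def
    by (subst det_transpose[symmetric]) (rule arg_cong[of _ _ det], simp add: vec_eq_iff transpose_def)
  have "linear g"
    by (intro linearI) (simp_all add: gT det_row_add flip: scalar_mult_eq_scaleR, simp_all add: det_row_mul)
  then have g: "g w = (\<Sum>i\<in>UNIV. w $ i * g (axis i 1))" for w
  proof -
    have "w = (\<Sum>i\<in>UNIV. w $ i *\<^sub>R axis i 1)"
      by (metis (no_types, lifting) basis_expansion scalar_mult_eq_scaleR sum.cong)
    then have "g w = g (\<Sum>i\<in>UNIV. w $ i *\<^sub>R axis i 1)" by simp
    then show ?thesis
      using \<open>linear g\<close> by (simp add: linear_sum linear_scale)
  qed
  define y :: "real ^ 'n option"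
    where "y = (\<chi> j. case j of None \<Rightarrow> - g x0 | Some i \<Rightarrow> - g (axis i 1))"
  have y: "ell_hom v y = g (v - x0)" for v
    using \<open>linear g\<close> by (simp add: ell_hom_def y_def linear_diff sum_negf flip: g)
  show ?thesis
  proof
    fix r assume r: "r \<in> \<rho>"
    show "ell_hom r y = 0"
    proof (cases "r = x0")
      case True
      then show ?thesis using \<open>linear g\<close> by (simp add: y linear_0)
    next
      case False
      then obtain j where "j \<noteq> k" "f j = r"
        using f r by (metis (no_types, lifting) Diff_iff bij_betw_imp_surj_on imageE insertCI singletonD)
      then show ?thesis
        unfolding y gT by (intro det_identical_rows[of j k]) (auto simp: row_def vec_eq_iff)
    qed
  next
    fix v assume v: "v \<notin> \<rho>"
    have "bij_betw (f(k := v)) (UNIV - {k}) (\<rho> - {x0})"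
      using f by (subst bij_betw_cong[of _ _ f]) auto
    moreover have "(f(k := v)) k \<notin> \<rho> - {x0}"
      using v by simp
    ultimately have "bij_betw (f(k := v)) (UNIV - {k} \<union> {k}) (\<rho> - {x0} \<union> {(f(k := v)) k})"
      by (intro notIn_Un_bij_betw) auto
    then have "bij_betw (f(k := v)) UNIV (insert v \<rho> - {x0})"
      using v x0 by (simp add: insert_Diff_if insert_absorb) (metis v)
    from content_simplex[OF _ _ _ this] 
    have "measure lborel (convex hull (insert v \<rho>)) = \<bar>det (\<chi> i j. (f(k := v)) j $ i - x0 $ i)\<bar> / fact CARD('n)"
      using assms v x0 by simp
    moreover have "convex hull (insert v \<rho>) \<in> sets borel"
      using assms(1) by (intro borel_compact finite_imp_compact_convex_hull) simp
    ultimately have "measure lebesgue (convex hull (insert v \<rho>)) = \<bar>det (\<chi> i j. (f(k := v)) j $ i - x0 $ i)\<bar> / fact CARD('n)"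
      by simp
    also have "(\<chi> i j. (f(k := v)) j $ i - x0 $ i) = A (v - x0)"
      by (auto simp: A_def vec_eq_iff)
    finally show "measure lebesgue (convex hull (insert v \<rho>)) = \<bar>ell_hom v y\<bar> / fact CARD('n)"
      by (simp add: y g_def)
  qed
qed

lemma simplex_wall_form:
  fixes \<rho> :: "(real ^ 'n) set"
  assumes "finite \<rho>" "card \<rho> = CARD('n)"
  obtains y :: "real ^ ('n::finite) option" where
    "\<And>r. r \<in> \<rho> \<Longrightarrow> ell_hom r y = 0"
    "\<And>v. v \<notin> \<rho> \<Longrightarrow> measure lebesgue (convex hull (insert v \<rho>)) = \<bar>ell_hom v y\<bar> / fact CARD('n)"
proof -
  obtain \<pi> :: "'n coord \<Rightarrow> 'n" where \<pi>: "bij \<pi>"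
    using finite_same_card_bij[of "UNIV :: 'n coord set" "UNIV :: 'n set"] card_coord by auto
  have inj: "inj (reindex \<pi>)"
    using \<pi> by (intro injI) (metis (mono_tags, lifting) bij_pointE reindex_def vec_eq_iff vec_lambda_beta)
  obtain z :: "real ^ 'n coord option" where
    z: "\<And>r. r \<in> reindex \<pi> ` \<rho> \<Longrightarrow> ell_hom r z = 0"
    "\<And>v. v \<notin> reindex \<pi> ` \<rho> \<Longrightarrow>
       measure lebesgue (convex hull (insert v (reindex \<pi> ` \<rho>))) = \<bar>ell_hom v z\<bar> / fact CARD('n coord)"
  proof (rule simplex_wall_form_wellorder[of "reindex \<pi> ` \<rho>"])
    show "card (reindex \<pi> ` \<rho>) = CARD('n coord)"
      using assms inj by (metis card_coord card_image inj_on_subset subset_UNIV)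
  qed (use assms in auto)
  define y :: "real ^ ('n::finite) option" where "y = (\<chi> j. z $ map_option (inv \<pi>) j)"
  have y: "ell_hom (reindex \<pi> v) z = ell_hom v y" for v
  proof -
    have "(\<Sum>j\<in>UNIV. v $ \<pi> j * z $ Some j) = (\<Sum>j\<in>UNIV. v $ \<pi> j * y $ Some (\<pi> j))"
      using \<pi> by (simp add: y_def bij_is_inj)
    also have "\<dots> = (\<Sum>i\<in>UNIV. v $ i * y $ Some i)"
      using \<pi> by (rule sum.reindex_bij_betw)
    finally show ?thesis by (simp add: ell_hom_def reindex_def y_def)
  qed
  show ?thesis
  proof
    fix v assume v: "v \<notin> \<rho>"
    have "convex hull (insert (reindex \<pi> v) (reindex \<pi> ` \<rho>)) = reindex \<pi> ` (convex hull (insert v \<rho>))"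
      by (simp add: convex_hull_linear_image linear_reindex)
    then have "measure lebesgue (convex hull (insert v \<rho>)) = measure lebesgue (convex hull (insert (reindex \<pi> v) (reindex \<pi> ` \<rho>)))"
      using \<pi> assms(1) by (simp add: measure_reindex finite_imp_compact_convex_hull)
    then show "measure lebesgue (convex hull (insert v \<rho>)) = \<bar>ell_hom v y\<bar> / fact CARD('n)"
      using z(2)[of "reindex \<pi> v"] v inj by (simp add: inj_image_mem_iff y card_coord)
  next
    fix r assume "r \<in> \<rho>"
    then show "ell_hom r y = 0"
      using z(1)[of "reindex \<pi> r"] y by simp
  qed
qed

section \<open>Walls of a triangulation\<close>

lemma simplex_vertices:
  fixes \<sigma> :: "(real ^ 'n) set"
  assumes "int CARD('n) simplex \<sigma>"
  shows "finite (vertices \<sigma>)" "card (vertices \<sigma>) = Suc CARD('n)" "convex hull (vertices \<sigma>) = \<sigma>"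
    "\<not> affine_dependent (vertices \<sigma>)" "affine hull (vertices \<sigma>) = UNIV"
proof -
  obtain C where C: "\<not> affine_dependent C" "int (card C) = int CARD('n) + 1" "\<sigma> = convex hull C"
    using assms by (auto simp: simplex_def)
  have "vertices \<sigma> = C"
    using C by (simp add: vertices_def extreme_point_of_convex_hull_affine_independent)
  with C show "finite (vertices \<sigma>)" "card (vertices \<sigma>) = Suc CARD('n)"
    "convex hull (vertices \<sigma>) = \<sigma>" "\<not> affine_dependent (vertices \<sigma>)"
    by (auto simp: aff_independent_finite)
  then show "affine hull (vertices \<sigma>) = UNIV"
    by (simp add: affine_independent_span_eq)
qed

lemma simplex_measure_pos:
  fixes \<sigma> :: "(real ^ 'n) set"
  assumes "int CARD('n) simplex \<sigma>"
  shows "0 < measure lebesgue \<sigma>"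
proof -
  note V = simplex_vertices[OF assms]
  have "interior \<sigma> \<noteq> {}"
    using V interior_convex_hull_eq_empty[of "vertices \<sigma>"] by simp
  moreover have "convex \<sigma>" "\<sigma> \<in> lmeasurable"
    using V(1) by (subst V(3)[symmetric], simp add: finite_imp_compact_convex_hull lmeasurable_compact)+
  ultimately show ?thesis
    using negligible_convex_interior[of \<sigma>] negligible_iff_measure0[of \<sigma>] by (simp add: zero_less_measure_iff)
qed

text \<open>
  Points near the barycenter of a wall on a given side are interior to every simplex with that wall on that
  side. As two simplices of a triangulation meet in a common face, they cannot share interior points
  unless they are equal.
\<close>

lemma simplex_le_across_wall:
  fixes \<rho> :: "(real ^ 'n) set"
  assumes \<sigma>: "int CARD('n) simplex \<sigma>" "vertices \<sigma> = insert v \<rho>" "v \<notin> \<rho>"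
    and \<sigma>': "int CARD('n) simplex \<sigma>'" "vertices \<sigma>' = insert v' \<rho>" "v' \<notin> \<rho>"
    and face: "(\<sigma> \<inter> \<sigma>') face_of \<sigma>"
    and y: "\<And>r. r \<in> \<rho> \<Longrightarrow> ell_hom r y = (0::real)"
    and side: "0 < ell_hom v y * ell_hom v' y"
  shows "\<sigma> \<subseteq> \<sigma>'"
proof -
  note V = simplex_vertices[OF \<sigma>(1)] and V' = simplex_vertices[OF \<sigma>'(1)]
  have fin: "finite \<rho>" and card: "card \<rho> = CARD('n)"
    using V \<sigma> by auto
  define n where "n = real (card \<rho>)"
  have n: "n > 0" by (simp add: n_def card)
  obtain u where u: "sum u (insert v' \<rho>) = 1" "(\<Sum>r\<in>insert v' \<rho>. u r *\<^sub>R r) = v"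
  proof -
    have "v \<in> affine hull (insert v' \<rho>)" using V'(5) \<sigma>' by simp
    then show ?thesis using that fin by (auto simp: affine_hull_finite)
  qed
  have "ell_hom v y = (\<Sum>r\<in>insert v' \<rho>. u r * ell_hom r y)"
    using ell_hom_affine_combination[of "insert v' \<rho>" u y] u fin by simp
  also have "\<dots> = u v' * ell_hom v' y"
    using fin \<sigma>'(3) y by simp
  finally have uv': "u v' > 0"
    using side by (simp add: zero_less_mult_iff) (auto simp: mult_less_0_iff)
  \<comment> \<open>Going from the barycenter of the wall towards \<open>v\<close> by the fraction \<open>e\<close> keeps the coordinates with respect to \<open>\<sigma>'\<close> positive.\<close>
  define B where "B = 1 + (\<Sum>r\<in>\<rho>. \<bar>u r\<bar>)"
  have B: "B \<ge> 1" "\<And>r. r \<in> \<rho> \<Longrightarrow> \<bar>u r\<bar> \<le> B"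
  proof -
    show "B \<ge> 1" unfolding B_def by (simp add: sum_nonneg)
    fix r assume "r \<in> \<rho>"
    then have "\<bar>u r\<bar> \<le> (\<Sum>r\<in>\<rho>. \<bar>u r\<bar>)"
      using fin by (intro member_le_sum) auto
    then show "\<bar>u r\<bar> \<le> B" by (simp add: B_def)
  qed
  define e where "e = 1 / (1 + (B + 1) * n)"
  have den: "1 + (B + 1) * n > 1" using B n by simp
  have e: "0 < e" "e < 1"
    using den by (auto simp: e_def)
  have e2: "e * B * n < 1 - e"
  proof -
    have "1 - e = e * ((B + 1) * n)" using den by (simp add: e_def field_simps)
    then show ?thesis using mult_pos_pos[OF e(1) n] by (simp add: algebra_simps)
  qed
  define z where "z = (\<Sum>r\<in>\<rho>. ((1 - e) / n) *\<^sub>R r) + e *\<^sub>R v"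
  have "z \<in> rel_interior (convex hull (insert v \<rho>))"
  proof (rule subsetD[OF explicit_subset_rel_interior_convex_hull_minimal])
    let ?c = "\<lambda>r. if r = v then e else (1 - e) / n"
    have "(\<forall>r\<in>insert v \<rho>. 0 < ?c r) \<and> sum ?c (insert v \<rho>) = 1 \<and> (\<Sum>r\<in>insert v \<rho>. ?c r *\<^sub>R r) = z"
    proof (intro conjI)
      have *: "sum ?c \<rho> = (\<Sum>r\<in>\<rho>. (1 - e) / n)"
        using \<sigma>(3) by (intro sum.cong) auto
      show "sum ?c (insert v \<rho>) = 1"
        using fin \<sigma>(3) * n by (simp add: n_def[symmetric])
      have "(\<Sum>r\<in>\<rho>. ?c r *\<^sub>R r) = (\<Sum>r\<in>\<rho>. ((1 - e) / n) *\<^sub>R r)"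
        using \<sigma>(3) by (intro sum.cong) auto
      then show "(\<Sum>r\<in>insert v \<rho>. ?c r *\<^sub>R r) = z"
        using fin \<sigma>(3) by (simp add: z_def add.commute)
    qed (use e n in auto)
    then show "z \<in> {y. \<exists>u. (\<forall>x\<in>insert v \<rho>. 0 < u x) \<and> sum u (insert v \<rho>) = 1 \<and> (\<Sum>x\<in>insert v \<rho>. u x *\<^sub>R x) = y}"
      by (intro CollectI exI[of _ ?c])
  qed (use fin in simp)
  then have z1: "z \<in> rel_interior \<sigma>"
    using V(3) \<sigma>(2) by simp
  have "z \<in> convex hull (insert v' \<rho>)"
  proof -
    let ?c = "\<lambda>r. if r = v' then e * u v' else (1 - e) / n + e * u r"
    have *: "sum ?c \<rho> = (\<Sum>r\<in>\<rho>. (1 - e) / n + e * u r)"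
      "(\<Sum>r\<in>\<rho>. ?c r *\<^sub>R r) = (\<Sum>r\<in>\<rho>. ((1 - e) / n + e * u r) *\<^sub>R r)"
      using \<sigma>'(3) by (auto intro!: sum.cong)
    have "0 \<le> ?c r" if "r \<in> insert v' \<rho>" for r
    proof (cases "r = v'")
      case False
      with that have "\<bar>u r\<bar> \<le> B" using B by auto
      then have "- B \<le> u r" by linarith
      then have "- (e * B) \<le> e * u r"
        using e mult_left_mono[of "- B" "u r" e] by simp
      moreover have "e * B < (1 - e) / n" using e2 n by (simp add: field_simps)
      ultimately show ?thesis using False by simp
    qed (use e uv' in simp)
    moreover have "sum ?c (insert v' \<rho>) = 1"
    proof -
      have "sum u \<rho> = 1 - u v'" using u fin \<sigma>'(3) by simp
      then show ?thesis
        using fin \<sigma>'(3) n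
        by (simp add: *(1) sum.distrib n_def[symmetric] sum_distrib_left[symmetric]) (simp add: algebra_simps)
    qed
    moreover have "(\<Sum>r\<in>insert v' \<rho>. ?c r *\<^sub>R r) = z"
    proof -
      have "e *\<^sub>R v = (e * u v') *\<^sub>R v' + (\<Sum>r\<in>\<rho>. (e * u r) *\<^sub>R r)"
        using fin \<sigma>'(3) by (simp add: u(2)[symmetric] scaleR_right_distrib scaleR_sum_right)
      then show ?thesis
        using fin \<sigma>'(3) * by (simp add: z_def scaleR_left_distrib sum.distrib)
    qed
    ultimately show ?thesis
      unfolding convex_hull_finite[OF finite.insertI[OF fin]] by (intro CollectI exI[of _ ?c]) blast
  qed
  then have "z \<in> \<sigma>'" using V'(3) \<sigma>'(2) by simp
  then have "(\<sigma> \<inter> \<sigma>') \<inter> rel_interior \<sigma> \<noteq> {}"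
    using z1 rel_interior_subset by blast
  then have "\<sigma> \<subseteq> \<sigma> \<inter> \<sigma>'"
    using subset_of_face_of[OF face] by simp
  then show ?thesis by simp
qed

text \<open>
  The segment from an interior point \<open>c\<close> of the wall to \<open>p\<close> is covered by finitely many closed simplices, so
  one of them contains \<open>c\<close> as well as a point of the open segment. It meets \<open>\<sigma>\<close> in a face through
  \<open>c\<close>, which therefore contains the whole wall.
\<close>

lemma exists_simplex_on_side:
  fixes \<T> :: "(real ^ 'n) set set"
  assumes tri: "triangulation \<T>" and simp: "\<And>\<sigma>. \<sigma> \<in> \<T> \<Longrightarrow> int CARD('n) simplex \<sigma>"
    and conv: "convex (\<Union>\<T>)"
    and \<sigma>: "\<sigma> \<in> \<T>" "vertices \<sigma> = insert v \<rho>" "v \<notin> \<rho>"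
    and y: "\<And>r. r \<in> \<rho> \<Longrightarrow> ell_hom r y = (0::real)"
    and p: "p \<in> \<Union>\<T>" "0 < ell_hom p y"
  obtains \<sigma>' v' where "\<sigma>' \<in> \<T>" "vertices \<sigma>' = insert v' \<rho>" "v' \<notin> \<rho>" "0 < ell_hom v' y"
proof -
  note V = simplex_vertices[OF simp[OF \<sigma>(1)]]
  have finT: "finite \<T>" using tri by (simp add: triangulation_def)
  have fin: "finite \<rho>" and card: "card \<rho> = CARD('n)"
    using V \<sigma> by auto
  have "rel_interior (convex hull \<rho>) \<noteq> {}"
    using card by (auto simp: rel_interior_eq_empty)
  then obtain c where c: "c \<in> rel_interior (convex hull \<rho>)" by blast
  then have c': "c \<in> convex hull \<rho>" using rel_interior_subset by blast
  have \<rho>\<sigma>: "convex hull \<rho> \<subseteq> \<sigma>"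
    using V(3) \<sigma>(2) by (metis hull_mono subset_insertI)
  have "ell_hom c y = 0"
  proof -
    obtain u where "sum u \<rho> = 1" "(\<Sum>r\<in>\<rho>. u r *\<^sub>R r) = c"
      using c' fin by (auto simp: convex_hull_finite)
    then show ?thesis
      using ell_hom_affine_combination[of \<rho> u y] fin y by simp
  qed
  with p have "c \<noteq> p" by auto
  have seg: "open_segment c p \<subseteq> \<Union>\<T>"
  proof -
    have "c \<in> \<Union>\<T>" using c' \<rho>\<sigma> \<sigma>(1) by blast
    then have "closed_segment c p \<subseteq> \<Union>\<T>"
      using conv p by (simp add: closed_segment_subset)
    then show ?thesis by (auto simp: open_segment_def)
  qed
  have "c \<in> closure (open_segment c p)"
    using \<open>c \<noteq> p\<close> by simp
  also have "open_segment c p = (\<Union>\<tau>\<in>\<T>. open_segment c p \<inter> \<tau>)"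
    using seg by blast
  also have "closure \<dots> = (\<Union>\<tau>\<in>\<T>. closure (open_segment c p \<inter> \<tau>))"
    using finT by (induction rule: finite_induct) (simp_all add: closure_Un)
  finally obtain \<tau> where \<tau>: "\<tau> \<in> \<T>" "c \<in> closure (open_segment c p \<inter> \<tau>)"
    by blast
  note W = simplex_vertices[OF simp[OF \<tau>(1)]]
  have "closed \<tau>"
    using W(1) by (subst W(3)[symmetric]) (simp add: compact_imp_closed finite_imp_compact_convex_hull)
  then have "c \<in> \<tau>"
    using \<tau>(2) closure_minimal[of "open_segment c p \<inter> \<tau>" \<tau>] by blast
  have "open_segment c p \<inter> \<tau> \<noteq> {}"
    using \<tau>(2) closure_empty by (metis empty_iff)
  then obtain z where z: "z \<in> open_segment c p" "z \<in> \<tau>" by blast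
  then obtain t where t: "0 < t" "z = (1 - t) *\<^sub>R c + t *\<^sub>R p"
    by (auto simp: in_segment)
  then have zy: "0 < ell_hom z y"
    using p \<open>ell_hom c y = 0\<close> by (simp add: ell_hom_segment)
  have f1: "(\<sigma> \<inter> \<tau>) face_of \<sigma>" and f2: "(\<sigma> \<inter> \<tau>) face_of \<tau>"
    using tri \<sigma>(1) \<tau>(1) unfolding triangulation_def by (blast, metis Int_commute)
  have "convex hull \<rho> \<subseteq> \<sigma> \<inter> \<tau>"
  proof (rule subset_of_face_of[OF f1 \<rho>\<sigma>])
    have "c \<in> \<sigma> \<inter> \<tau>" using c' \<rho>\<sigma> \<open>c \<in> \<tau>\<close> by auto
    with c show "(\<sigma> \<inter> \<tau>) \<inter> rel_interior (convex hull \<rho>) \<noteq> {}" by auto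
  qed
  have sub: "\<rho> \<subseteq> vertices \<tau>"
  proof
    fix r assume r: "r \<in> \<rho>"
    then have "r extreme_point_of \<sigma>" using \<sigma>(2) by (auto simp: vertices_def)
    moreover have "r \<in> \<sigma> \<inter> \<tau>" using r \<open>convex hull \<rho> \<subseteq> \<sigma> \<inter> \<tau>\<close> by (meson hull_inc subsetD)
    ultimately have "r extreme_point_of (\<sigma> \<inter> \<tau>)"
      using f1 by (simp add: extreme_point_of_face)
    then show "r \<in> vertices \<tau>"
      using f2 by (simp add: extreme_point_of_face vertices_def)
  qed
  have "card (vertices \<tau> - \<rho>) = 1"
    using sub W fin card by (simp add: card_Diff_subset)
  then obtain v' where v': "vertices \<tau> - \<rho> = {v'}" by (auto simp: card_1_singleton_iff)
  then have Vt: "vertices \<tau> = insert v' \<rho>" "v' \<notin> \<rho>" using sub by auto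
  obtain u where u: "\<forall>r\<in>insert v' \<rho>. 0 \<le> u r" "sum u (insert v' \<rho>) = 1" "(\<Sum>r\<in>insert v' \<rho>. u r *\<^sub>R r) = z"
    using z(2) W(3) Vt(1) fin by (auto simp: convex_hull_finite)
  have "ell_hom z y = (\<Sum>r\<in>insert v' \<rho>. u r * ell_hom r y)"
    using ell_hom_affine_combination[of "insert v' \<rho>" u y] u fin by simp
  also have "\<dots> = u v' * ell_hom v' y"
    using fin Vt(2) y by simp
  finally have "0 < ell_hom v' y"
    using zy u(1) by (simp add: zero_less_mult_iff)
  then show thesis
    using that \<tau>(1) Vt by blast
qed

section \<open>Vanishing of the adjoint polynomial\<close>

definition simplices_at_wall :: "(real ^ 'n) set set \<Rightarrow> (real ^ 'n) set \<Rightarrow> ((real ^ 'n) set \<times> (real ^ 'n)) set" where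
  "simplices_at_wall \<T> \<rho> = {(\<sigma>, v). \<sigma> \<in> \<T> \<and> v \<in> vertices \<sigma> \<and> vertices \<sigma> - {v} = \<rho>}"

lemma simplices_at_wallD:
  assumes "(\<sigma>, v) \<in> simplices_at_wall \<T> \<rho>"
  shows "\<sigma> \<in> \<T>" "vertices \<sigma> = insert v \<rho>" "v \<notin> \<rho>"
  using assms by (auto simp: simplices_at_wall_def)

lemma simplices_at_wallI:
  assumes "\<sigma> \<in> \<T>" "vertices \<sigma> = insert v \<rho>" "v \<notin> \<rho>"
  shows "(\<sigma>, v) \<in> simplices_at_wall \<T> \<rho>"
  using assms by (auto simp: simplices_at_wall_def)

text \<open>
  Exactly one simplex lies on either side. The points \<open>p\<close> and \<open>q\<close> say that the wall is not contained in the
  boundary of the triangulated region.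
\<close>

lemma wall_signs_cancel:
  fixes \<T> :: "(real ^ 'n) set set" and y :: "real ^ 'n option"
  assumes tri: "triangulation \<T>" and simp: "\<And>\<sigma>. \<sigma> \<in> \<T> \<Longrightarrow> int CARD('n) simplex \<sigma>"
    and conv: "convex (\<Union>\<T>)"
    and ne: "simplices_at_wall \<T> \<rho> \<noteq> {}"
    and y: "\<And>r. r \<in> \<rho> \<Longrightarrow> ell_hom r y = 0"
    and p: "p \<in> \<Union>\<T>" "0 < ell_hom p y" and q: "q \<in> \<Union>\<T>" "ell_hom q y < 0"
  shows "(\<Sum>(\<sigma>, v)\<in>simplices_at_wall \<T> \<rho>. sgn (ell_hom v y)) = 0"
proof -
  let ?A = "simplices_at_wall \<T> \<rho>"
  obtain \<sigma>0 v0 where "(\<sigma>0, v0) \<in> ?A" using ne by auto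
  note s0 = simplices_at_wallD[OF this]
  obtain \<sigma>1 v1 where s1: "(\<sigma>1, v1) \<in> ?A" "0 < ell_hom v1 y"
    by (rule exists_simplex_on_side[OF tri simp conv s0 y p]) (auto intro: simplices_at_wallI)
  have y': "\<And>r. r \<in> \<rho> \<Longrightarrow> ell_hom r (- y) = 0" and q': "0 < ell_hom q (- y)"
    using y q by (simp_all add: ell_hom_right_linear)
  obtain \<sigma>2 v2 where s2: "(\<sigma>2, v2) \<in> ?A" "ell_hom v2 y < 0"
    by (rule exists_simplex_on_side[OF tri simp conv s0 y' q(1) q'])
       (auto intro: simplices_at_wallI simp: ell_hom_right_linear)
  have uniq: "a = a'"
    if "a \<in> ?A" "a' \<in> ?A" "0 < ell_hom (snd a) y * ell_hom (snd a') y" for a a'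
  proof -
    obtain \<sigma> v \<sigma>' v' where a: "a = (\<sigma>, v)" "a' = (\<sigma>', v')" by (metis surj_pair)
    note d = simplices_at_wallD[OF that(1)[unfolded a]] and d' = simplices_at_wallD[OF that(2)[unfolded a]]
    have f: "(\<sigma> \<inter> \<sigma>') face_of \<sigma>" "(\<sigma>' \<inter> \<sigma>) face_of \<sigma>'"
      using tri d(1) d'(1) unfolding triangulation_def by blast+
    have "\<sigma> = \<sigma>'"
    proof
      show "\<sigma> \<subseteq> \<sigma>'"
        by (rule simplex_le_across_wall[OF simp[OF d(1)] d(2,3) simp[OF d'(1)] d'(2,3) f(1) y])
           (use that(3) a in auto)
      show "\<sigma>' \<subseteq> \<sigma>"
        by (rule simplex_le_across_wall[OF simp[OF d'(1)] d'(2,3) simp[OF d(1)] d(2,3) f(2) y])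
           (use that(3) a in \<open>auto simp: mult.commute\<close>)
    qed
    moreover from this have "v = v'" using d d' by blast
    ultimately show ?thesis using a by simp
  qed
  have fin: "finite ?A"
  proof (rule finite_subset)
    show "?A \<subseteq> Sigma \<T> vertices" by (auto simp: simplices_at_wall_def)
    show "finite (Sigma \<T> vertices)"
      using tri simp by (auto simp: triangulation_def intro: simplex_vertices)
  qed
  have "(\<Sum>(\<sigma>, v)\<in>?A. sgn (ell_hom v y)) = (\<Sum>(\<sigma>, v)\<in>{(\<sigma>1, v1), (\<sigma>2, v2)}. sgn (ell_hom v y))"
  proof (rule sum.mono_neutral_right[OF fin])
    show "\<forall>i\<in>?A - {(\<sigma>1, v1), (\<sigma>2, v2)}. (case i of (\<sigma>, v) \<Rightarrow> sgn (ell_hom v y)) = 0"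
    proof
      fix i assume i: "i \<in> ?A - {(\<sigma>1, v1), (\<sigma>2, v2)}"
      then have "\<not> 0 < ell_hom (snd i) y" "\<not> ell_hom (snd i) y < 0"
        using uniq[of i "(\<sigma>1, v1)"] uniq[of i "(\<sigma>2, v2)"] s1 s2
        by (auto simp: zero_less_mult_iff)
      then show "(case i of (\<sigma>, v) \<Rightarrow> sgn (ell_hom v y)) = 0"
        by (cases i) auto
    qed
  qed (use s1 s2 in auto)
  also have "\<dots> = 0"
  proof -
    have "v1 \<noteq> v2" using s1 s2 by auto
    then show ?thesis using s1 s2 by simp
  qed
  finally show ?thesis .
qed

text \<open>
  The coefficient vectors \<open>(1, -a)\<close> of the forms \<open>\<ell>\<^sub>a\<close>, for \<open>a\<close> in affine space, span all covectors.
\<close>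

lemma exists_affine_point_off:
  fixes x :: "complex ^ (('n::finite) option)"
  assumes "x \<noteq> 0"
  obtains a :: "real ^ 'n" where "ell_hom a x \<noteq> 0"
proof (cases "x $ None = 0")
  case False
  then show ?thesis using that[of 0] by (simp add: ell_hom_def)
next
  case True
  then obtain i where "x $ Some i \<noteq> 0"
    using assms by (metis (mono_tags) not_None_eq vec_eq_iff zero_index)
  moreover have "ell_hom (axis i 1) x = - x $ Some i"
    using True by (simp add: ell_hom_def axis_def if_distrib[of of_real] if_distrib[of "\<lambda>c. c * _"] cong: if_cong)
  ultimately show ?thesis using that[of "axis i 1"] by simp
qed

text \<open>
  The hypothesis \<open>interior\<close> says that the vertices whose forms vanish at \<open>x\<close> lie in no proper face of
  \<open>P\<close>: a nonzero \<open>y\<close> violating it would be a linear inequality valid on \<open>P\<close> and tight at all of them.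
\<close>

lemma warren_adjoint_vanishes:
  fixes P :: "(real ^ 'n) set" and x :: "complex ^ 'n option"
  assumes tri: "vertex_triangulation P \<T>" and "convex P" and finV: "finite (vertices P)"
    and x: "x \<noteq> 0"
    and interior: "\<And>y :: real ^ 'n option. y \<in> dual_cone P \<Longrightarrow>
      (\<And>v. v \<in> vertices P \<Longrightarrow> ell_hom v x = 0 \<Longrightarrow> ell_hom v y = 0) \<Longrightarrow> y = 0"
  shows "warren_adjoint_hom P \<T> x = 0"
proof -
  let ?V = "vertices P"
  have tr: "triangulation \<T>" and P: "\<Union>\<T> = P" and simp: "\<And>\<sigma>. \<sigma> \<in> \<T> \<Longrightarrow> int CARD('n) simplex \<sigma>"
    and sub: "\<And>\<sigma>. \<sigma> \<in> \<T> \<Longrightarrow> vertices \<sigma> \<subseteq> ?V"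
    using tri by (auto simp: vertex_triangulation_def)
  have conv: "convex (\<Union>\<T>)" using P \<open>convex P\<close> by simp
  have finT: "finite \<T>" using tr by (simp add: triangulation_def)
  have VP: "?V \<subseteq> \<Union>\<T>" using P by (auto simp: vertices_def extreme_point_of_def)
  obtain a :: "real ^ 'n" where a: "ell_hom a x \<noteq> 0"
    using exists_affine_point_off[OF x] .
  have "\<exists>c. sum c (vertices \<sigma>) = 1 \<and> (\<Sum>v\<in>vertices \<sigma>. c v *\<^sub>R v) = a" if "\<sigma> \<in> \<T>" for \<sigma>
  proof -
    have "a \<in> affine hull (vertices \<sigma>)"
      using simplex_vertices(5)[OF simp[OF that]] by simp
    then show ?thesis
      using simplex_vertices(1)[OF simp[OF that]] by (auto simp: affine_hull_finite)
  qed
  then obtain c where c: "\<And>\<sigma>. \<sigma> \<in> \<T> \<Longrightarrow> sum (c \<sigma>) (vertices \<sigma>) = 1"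
    "\<And>\<sigma>. \<sigma> \<in> \<T> \<Longrightarrow> (\<Sum>v\<in>vertices \<sigma>. c \<sigma> v *\<^sub>R v) = a"
    by metis
  define pr where "pr \<rho> = (\<Prod>u\<in>?V - \<rho>. ell_hom u x)" for \<rho>
  define h where "h = (\<lambda>(\<sigma>, v). complex_of_real (measure lebesgue \<sigma> * c \<sigma> v) * pr (vertices \<sigma> - {v}))"
  have "ell_hom a x * warren_adjoint_hom P \<T> x
      = (\<Sum>\<sigma>\<in>\<T>. ell_hom a x * (of_real (measure lebesgue \<sigma>) * pr (vertices \<sigma>)))"
    by (simp add: warren_adjoint_hom_def pr_def sum_distrib_left)
  also have "\<dots> = (\<Sum>\<sigma>\<in>\<T>. \<Sum>v\<in>vertices \<sigma>. h (\<sigma>, v))"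
  proof (rule sum.cong[OF refl])
    fix \<sigma> assume \<sigma>: "\<sigma> \<in> \<T>"
    note V = simplex_vertices[OF simp[OF \<sigma>]]
    have "ell_hom a x = (\<Sum>v\<in>vertices \<sigma>. of_real (c \<sigma> v) * ell_hom v x)"
      using ell_hom_affine_combination[OF V(1) c(1)[OF \<sigma>], of x] c(2)[OF \<sigma>] by simp
    moreover have "of_real (c \<sigma> v) * ell_hom v x * (of_real (measure lebesgue \<sigma>) * pr (vertices \<sigma>)) = h (\<sigma>, v)"
      if v: "v \<in> vertices \<sigma>" for v
    proof -
      have "?V - (vertices \<sigma> - {v}) = insert v (?V - vertices \<sigma>)"
        using v sub[OF \<sigma>] by auto
      then have "pr (vertices \<sigma> - {v}) = ell_hom v x * pr (vertices \<sigma>)"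
        using v finV by (simp add: pr_def)
      then show ?thesis by (simp add: h_def)
    qed
    ultimately show "ell_hom a x * (of_real (measure lebesgue \<sigma>) * pr (vertices \<sigma>)) = (\<Sum>v\<in>vertices \<sigma>. h (\<sigma>, v))"
      by (simp add: sum_distrib_right)
  qed
  also have "\<dots> = sum h (Sigma \<T> vertices)"
    using finT simplex_vertices(1)[OF simp] by (subst sum.Sigma) auto
  also have "\<dots> = (\<Sum>\<rho>\<in>(\<lambda>(\<sigma>, v). vertices \<sigma> - {v}) ` Sigma \<T> vertices.
                    sum h {s \<in> Sigma \<T> vertices. (\<lambda>(\<sigma>, v). vertices \<sigma> - {v}) s = \<rho>})"
    using finT simplex_vertices(1)[OF simp] by (intro sum.image_gen) auto
  also have "\<dots> = 0"
  proof (rule sum.neutral, rule ballI)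
    fix \<rho> assume "\<rho> \<in> (\<lambda>(\<sigma>, v). vertices \<sigma> - {v}) ` Sigma \<T> vertices"
    then obtain \<sigma>0 v0 where s0: "(\<sigma>0, v0) \<in> simplices_at_wall \<T> \<rho>"
      by (auto simp: simplices_at_wall_def)
    have A: "{s \<in> Sigma \<T> vertices. (\<lambda>(\<sigma>, v). vertices \<sigma> - {v}) s = \<rho>} = simplices_at_wall \<T> \<rho>"
      by (auto simp: simplices_at_wall_def)
    note d0 = simplices_at_wallD[OF s0] and V0 = simplex_vertices[OF simp[OF simplices_at_wallD(1)[OF s0]]]
    have fin\<rho>: "finite \<rho>" and card\<rho>: "card \<rho> = CARD('n)"
      using V0 d0 by auto
    obtain y :: "real ^ 'n option" where y: "\<And>r. r \<in> \<rho> \<Longrightarrow> ell_hom r y = 0"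
      "\<And>v. v \<notin> \<rho> \<Longrightarrow> measure lebesgue (convex hull (insert v \<rho>)) = \<bar>ell_hom v y\<bar> / fact CARD('n)"
      using simplex_wall_form[OF fin\<rho> card\<rho>] by blast
    \<comment> \<open>All terms of the wall \<open>\<rho>\<close> are \<open>K\<close> or \<open>- K\<close>, or zero for a degenerate wall.\<close>
    define K where "K = complex_of_real (ell_hom a y / fact CARD('n)) * pr \<rho>"
    have h: "h s = of_real (sgn (ell_hom (snd s) y)) * K" if "s \<in> simplices_at_wall \<T> \<rho>" for s
    proof -
      obtain \<sigma> v where s: "s = (\<sigma>, v)" by (cases s)
      note d = simplices_at_wallD[OF that[unfolded s]]
      note V = simplex_vertices[OF simp[OF d(1)]]
      have "ell_hom a y = (\<Sum>r\<in>insert v \<rho>. c \<sigma> r * ell_hom r y)"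
        using ell_hom_affine_combination[OF V(1) c(1)[OF d(1)], of y] c(2)[OF d(1)] d(2) by simp
      also have "\<dots> = c \<sigma> v * ell_hom v y"
        using d fin\<rho> y(1) by simp
      finally have 1: "ell_hom a y = c \<sigma> v * ell_hom v y" .
      have "measure lebesgue \<sigma> = \<bar>ell_hom v y\<bar> / fact CARD('n)"
        using y(2)[OF d(3)] V(3) d(2) by simp
      then have "measure lebesgue \<sigma> * c \<sigma> v = sgn (ell_hom v y) * (ell_hom a y / fact CARD('n))"
        unfolding 1 by (simp add: abs_sgn)
      moreover have "vertices \<sigma> - {v} = \<rho>" using d by auto
      ultimately have "h s = of_real (sgn (ell_hom v y) * (ell_hom a y / fact CARD('n))) * pr \<rho>"
        by (simp only: h_def s case_prod_conv)
      then show ?thesis by (simp add: s K_def)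
    qed
    have "sum h (simplices_at_wall \<T> \<rho>)
        = of_real (\<Sum>s\<in>simplices_at_wall \<T> \<rho>. sgn (ell_hom (snd s) y)) * K"
      using h by (simp add: sum_distrib_right)
    also have "\<dots> = 0"
    proof (cases "\<exists>z\<in>?V - \<rho>. ell_hom z x = 0")
      case True
      then have "pr \<rho> = 0" using finV by (auto simp: pr_def)
      then show ?thesis by (simp add: K_def)
    next
      case False
      have yz: "ell_hom v y = 0" if "v \<in> ?V" "ell_hom v x = 0" for v
        using that False y(1) by blast
      show ?thesis
      proof (cases "y = 0")
        case True
        then show ?thesis by (simp add: ell_hom_right_linear)
      next
        \<comment> \<open>The wall has vertices of \<open>P\<close> on both sides, since neither \<open>y\<close> nor \<open>- y\<close> is nonnegative on \<open>P\<close>.\<close>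
        case y0: False
        then have "y \<notin> dual_cone P" using interior[of y] yz by blast
        then obtain q where q: "q \<in> ?V" "ell_hom q y < 0" by (auto simp: dual_cone_def not_le)
        have "- y \<notin> dual_cone P" using interior[of "- y"] yz y0 by (auto simp: ell_hom_right_linear)
        then obtain p where p: "p \<in> ?V" "0 < ell_hom p y"
          by (auto simp: dual_cone_def not_le ell_hom_right_linear)
        have "(\<Sum>(\<sigma>, v)\<in>simplices_at_wall \<T> \<rho>. sgn (ell_hom v y)) = 0"
          by (rule wall_signs_cancel[OF tr simp conv _ y(1)]) (use s0 p q VP in auto)
        then show ?thesis by (simp add: case_prod_beta)
      qed
    qed
    finally show "sum h {s \<in> Sigma \<T> vertices. (\<lambda>(\<sigma>, v). vertices \<sigma> - {v}) s = \<rho>} = 0"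
      using A by simp
  qed
  finally show ?thesis using a by simp
qed

section \<open>Homogeneous forms\<close>

lemma finite_exponents: "finite {\<alpha> :: 'm::finite \<Rightarrow> nat. sum \<alpha> UNIV = k}"
proof (rule finite_subset)
  show "{\<alpha> :: 'm \<Rightarrow> nat. sum \<alpha> UNIV = k} \<subseteq> PiE UNIV (\<lambda>_. {..k})"
    by (auto simp: PiE_def intro!: member_le_sum)
qed (simp add: finite_PiE)

lemma homogeneous_poly_monomial:
  "homogeneous_poly (sum \<beta> UNIV) (\<lambda>x. \<Prod>i\<in>UNIV. (x $ i) ^ \<beta> i)"
  unfolding homogeneous_poly_def
  by (rule exI[of _ "\<lambda>\<alpha>. if \<alpha> = \<beta> then 1 else 0"])
     (simp add: finite_exponents if_distrib[of "\<lambda>c. c * _"] cong: if_cong)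

lemma homogeneous_poly_add:
  assumes "homogeneous_poly k f" "homogeneous_poly k g"
  shows "homogeneous_poly k (\<lambda>x. f x + g x)"
proof -
  obtain c d where "\<forall>x. f x = (\<Sum>\<alpha> | (\<Sum>i\<in>UNIV. \<alpha> i) = k. c \<alpha> * (\<Prod>i\<in>UNIV. (x $ i) ^ \<alpha> i))"
    "\<forall>x. g x = (\<Sum>\<alpha> | (\<Sum>i\<in>UNIV. \<alpha> i) = k. d \<alpha> * (\<Prod>i\<in>UNIV. (x $ i) ^ \<alpha> i))"
    using assms by (auto simp: homogeneous_poly_def)
  then show ?thesis
    unfolding homogeneous_poly_def
    by (intro exI[of _ "\<lambda>\<alpha>. c \<alpha> + d \<alpha>"]) (simp add: sum.distrib distrib_right)
qed

lemma homogeneous_poly_scale: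
  assumes "homogeneous_poly k f"
  shows "homogeneous_poly k (\<lambda>x. a * f x)"
proof -
  obtain c where "\<forall>x. f x = (\<Sum>\<alpha> | (\<Sum>i\<in>UNIV. \<alpha> i) = k. c \<alpha> * (\<Prod>i\<in>UNIV. (x $ i) ^ \<alpha> i))"
    using assms by (auto simp: homogeneous_poly_def)
  then show ?thesis
    unfolding homogeneous_poly_def
    by (intro exI[of _ "\<lambda>\<alpha>. a * c \<alpha>"]) (simp add: sum_distrib_left mult.assoc)
qed

lemma homogeneous_poly_sum:
  assumes "\<And>s. s \<in> S \<Longrightarrow> homogeneous_poly k (f s)"
  shows "homogeneous_poly k (\<lambda>x. \<Sum>s\<in>S. f s x)"
proof -
  have zero: "homogeneous_poly k (\<lambda>x. 0)"
    unfolding homogeneous_poly_def by (intro exI[of _ "\<lambda>_. 0"]) simp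
  show ?thesis
    using assms
    by (induction S rule: infinite_finite_induct) (simp_all add: zero homogeneous_poly_add)
qed

lemma homogeneous_poly_coordinate_mult:
  assumes "homogeneous_poly k f"
  shows "homogeneous_poly (Suc k) (\<lambda>x. x $ i * f x)"
proof -
  obtain c where c: "\<And>x. f x = (\<Sum>\<alpha> | (\<Sum>i\<in>UNIV. \<alpha> i) = k. c \<alpha> * (\<Prod>i\<in>UNIV. (x $ i) ^ \<alpha> i))"
    using assms by (auto simp: homogeneous_poly_def)
  have step: "x $ i * (\<Prod>j\<in>UNIV. (x $ j) ^ \<alpha> j) = (\<Prod>j\<in>UNIV. (x $ j) ^ (\<alpha>(i := Suc (\<alpha> i))) j)"
    for x :: "complex ^ 'a" and \<alpha>
    by (subst (1 2) prod.remove[of _ i]) (auto intro!: prod.cong)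
  have "homogeneous_poly (Suc k) (\<lambda>x. \<Sum>\<alpha> | (\<Sum>i\<in>UNIV. \<alpha> i) = k.
          c \<alpha> * (\<Prod>j\<in>UNIV. (x $ j) ^ (\<alpha>(i := Suc (\<alpha> i))) j))"
  proof (intro homogeneous_poly_sum homogeneous_poly_scale)
    fix \<alpha> :: "'a \<Rightarrow> nat" assume "\<alpha> \<in> {\<alpha>. sum \<alpha> UNIV = k}"
    moreover have "sum (\<alpha>(i := Suc (\<alpha> i))) UNIV = Suc (sum \<alpha> UNIV)"
      by (subst (1 2) sum.remove[of _ i]) (auto intro!: sum.cong)
    ultimately show "homogeneous_poly (Suc k) (\<lambda>x. \<Prod>j\<in>UNIV. (x $ j) ^ (\<alpha>(i := Suc (\<alpha> i))) j)"
      using homogeneous_poly_monomial[of "\<alpha>(i := Suc (\<alpha> i))"] by simp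
  qed
  then show ?thesis
    by (simp only: c sum_distrib_left step[symmetric] mult.left_commute)
qed

lemma homogeneous_poly_ell_hom_mult:
  assumes "homogeneous_poly k f"
  shows "homogeneous_poly (Suc k) (\<lambda>x. ell_hom v x * f x)"
proof -
  have "homogeneous_poly (Suc k) (\<lambda>x. x $ None * f x + (\<Sum>i\<in>UNIV. - of_real (v $ i) * (x $ Some i * f x)))"
    by (intro homogeneous_poly_add homogeneous_poly_sum homogeneous_poly_scale
          homogeneous_poly_coordinate_mult assms)
  also have "(\<lambda>x. x $ None * f x + (\<Sum>i\<in>UNIV. - of_real (v $ i) * (x $ Some i * f x)))
      = (\<lambda>x. ell_hom v x * f x)"
    by (rule ext) (simp add: ell_hom_def sum_negf sum_distrib_left algebra_simps)
  finally show ?thesis .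
qed

lemma homogeneous_poly_prod_ell_hom:
  assumes "finite S"
  shows "homogeneous_poly (card S) (\<lambda>x. \<Prod>v\<in>S. ell_hom v x)"
  using assms
proof (induction S)
  case empty
  show ?case using homogeneous_poly_monomial[of "\<lambda>_. 0"] by simp
next
  case (insert v S)
  then show ?case using homogeneous_poly_ell_hom_mult by fastforce
qed

lemma homogeneous_poly_ell_hom: "homogeneous_poly 1 (ell_hom v)"
  using homogeneous_poly_prod_ell_hom[of "{v}"] by simp

lemma homogeneous_poly_homogeneous:
  assumes "homogeneous_poly k f"
  shows "f (a *s x) = a ^ k * f x"
proof -
  obtain c where c: "\<And>x. f x = (\<Sum>\<alpha> | (\<Sum>i\<in>UNIV. \<alpha> i) = k. c \<alpha> * (\<Prod>i\<in>UNIV. (x $ i) ^ \<alpha> i))"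
    using assms by (auto simp: homogeneous_poly_def)
  show ?thesis
    unfolding c sum_distrib_left
    by (intro sum.cong) (auto simp: power_mult_distrib prod.distrib power_sum[symmetric])
qed

lemma homogeneous_poly_on_line:
  assumes "homogeneous_poly k f"
  obtains q where "degree q \<le> k" "\<And>t. f (p + t *s r) = poly q t"
proof -
  obtain c where c: "\<And>x. f x = (\<Sum>\<alpha> | (\<Sum>i\<in>UNIV. \<alpha> i) = k. c \<alpha> * (\<Prod>i\<in>UNIV. (x $ i) ^ \<alpha> i))"
    using assms by (auto simp: homogeneous_poly_def)
  define q where "q = (\<Sum>\<alpha> | (\<Sum>i\<in>UNIV. \<alpha> i) = k. smult (c \<alpha>) (\<Prod>i\<in>UNIV. [:p $ i, r $ i:] ^ \<alpha> i))"
  show thesis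
  proof
    show "degree q \<le> k"
      unfolding q_def
    proof (rule degree_sum_le[OF finite_exponents])
      fix \<alpha> :: "'a \<Rightarrow> nat" assume "\<alpha> \<in> {\<alpha>. sum \<alpha> UNIV = k}"
      then have k: "k = sum \<alpha> UNIV" by simp
      have "degree (\<Prod>i\<in>UNIV. [:p $ i, r $ i:] ^ \<alpha> i) \<le> (\<Sum>i\<in>UNIV. degree ([:p $ i, r $ i:] ^ \<alpha> i))"
        using degree_prod_sum_le[of UNIV "\<lambda>i. [:p $ i, r $ i:] ^ \<alpha> i"] by (simp add: o_def)
      also have "\<dots> \<le> (\<Sum>i\<in>UNIV. \<alpha> i)"
      proof (rule sum_mono)
        fix i
        have "degree ([:p $ i, r $ i:] ^ \<alpha> i) \<le> degree [:p $ i, r $ i:] * \<alpha> i"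
          by (rule degree_power_le)
        also have "\<dots> \<le> 1 * \<alpha> i" by (intro mult_le_mono1) simp
        finally show "degree ([:p $ i, r $ i:] ^ \<alpha> i) \<le> \<alpha> i" by simp
      qed
      finally show "degree (smult (c \<alpha>) (\<Prod>i\<in>UNIV. [:p $ i, r $ i:] ^ \<alpha> i)) \<le> k"
        using degree_smult_le k by (metis order_trans)
    qed
    show "f (p + t *s r) = poly q t" for t
      by (simp add: c q_def poly_sum poly_prod mult.commute)
  qed
qed

section \<open>The facets of the dual cone\<close>

definition cone_facet :: "(real ^ 'n) set \<Rightarrow> real ^ 'n \<Rightarrow> (real ^ (('n::finite) option)) set" where
  "cone_facet P v = dual_cone P \<inter> {y. ell_hom v y = 0}"

definition polar_hyperplane :: "real ^ 'n \<Rightarrow> (complex ^ (('n::finite) option)) set" where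
  "polar_hyperplane v = zero_locus (ell_hom v)"

lemma sum_UNIV_option: "sum f (UNIV :: ('n::finite) option set) = f None + (\<Sum>i\<in>UNIV. f (Some i))"
  by (simp add: UNIV_option_conv sum.reindex)

lemma ell_hom_inner:
  fixes y :: "real ^ (('n::finite) option)"
  shows "ell_hom v y = (\<chi> j. case j of None \<Rightarrow> 1 | Some i \<Rightarrow> - (v $ i)) \<bullet> y"
  by (simp add: ell_hom_def inner_vec_def sum_UNIV_option sum_negf)

lemma homogenized_nonzero: "(\<chi> j. case j of None \<Rightarrow> 1 | Some i \<Rightarrow> - (v $ i)) \<noteq> (0 :: real ^ (('n::finite) option))"
  by (auto simp: vec_eq_iff intro!: exI[of _ None])

lemma open_ell_hom_pos: "finite W \<Longrightarrow> open {y :: real ^ (('n::finite) option). \<forall>v\<in>W. 0 < ell_hom v y}"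
  unfolding ell_hom_inner
  by (simp add: Collect_ball_eq open_INT open_halfspace_gt)

lemma aff_dim_ell_hom_hyperplane:
  "aff_dim {y :: real ^ (('n::finite) option). ell_hom v y = 0} = int CARD('n)"
  unfolding ell_hom_inner by (subst aff_dim_hyperplane) (simp_all add: homogenized_nonzero)

lemma convex_dual_cone: "convex (dual_cone P)"
  unfolding dual_cone_def ell_hom_inner
  by (simp add: Collect_ball_eq convex_INT convex_halfspace_ge)

lemma positive_in_interior_dual_cone:
  assumes "finite (vertices P)" "\<And>v. v \<in> vertices P \<Longrightarrow> 0 < ell_hom v y"
  shows "y \<in> interior (dual_cone P)"
  by (rule interiorI[OF open_ell_hom_pos[OF assms(1)]]) (use assms(2) in \<open>auto simp: dual_cone_def less_imp_le\<close>)

lemma aff_dim_dual_cone: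
  fixes P :: "(real ^ 'n) set"
  assumes "finite (vertices P)"
  shows "aff_dim (dual_cone P) = int CARD('n) + 1"
proof -
  have "ell_hom v (axis None 1 :: real ^ 'n option) = 1" for v
    by (simp add: ell_hom_def axis_def)
  then have "axis None 1 \<in> interior (dual_cone P)"
    by (intro positive_in_interior_dual_cone assms) simp
  then have "aff_dim (dual_cone P) = int DIM(real ^ 'n option)"
    by (intro aff_dim_nonempty_interior) auto
  then show ?thesis by (simp add: card_UNIV_option)
qed

lemma cone_facet_face: "v \<in> vertices P \<Longrightarrow> cone_facet P v face_of dual_cone P"
  unfolding cone_facet_def ell_hom_inner
  by (rule face_of_Int_supporting_hyperplane_ge[OF convex_dual_cone])
     (simp add: dual_cone_def ell_hom_inner)

text \<open>
  A relatively interior point of a facet is on the boundary of the cone, so some \<open>\<ell>\<^sub>v\<close> vanishes at it, and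
  hence on the whole facet; the face cut out by \<open>\<ell>\<^sub>v\<close> cannot be larger for dimension reasons.
\<close>

lemma facet_of_dual_cone_imp:
  fixes P :: "(real ^ 'n) set"
  assumes fin: "finite (vertices P)" and F: "F facet_of dual_cone P"
  obtains v where "v \<in> vertices P" "F = cone_facet P v"
proof -
  have face: "F face_of dual_cone P" and "F \<noteq> {}" and dim: "aff_dim F = int CARD('n)"
    using F aff_dim_dual_cone[OF fin] by (auto simp: facet_of_def)
  have "F \<noteq> dual_cone P" using dim aff_dim_dual_cone[OF fin] by auto
  have "convex F" using face by (rule face_of_imp_convex)
  then obtain y where y: "y \<in> rel_interior F"
    using \<open>F \<noteq> {}\<close> rel_interior_eq_empty by blast
  then have "y \<in> F" using rel_interior_subset by blast
  then have "y \<in> dual_cone P" "y \<notin> interior (dual_cone P)"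
    using face_of_imp_subset[OF face] face_of_disjoint_interior[OF face \<open>F \<noteq> dual_cone P\<close>] by auto
  then obtain v where v: "v \<in> vertices P" "ell_hom v y = 0"
    using positive_in_interior_dual_cone[OF fin, of y] by (force simp: dual_cone_def)
  have "F \<subseteq> cone_facet P v"
  proof (rule subset_of_face_of[OF cone_facet_face[OF v(1)]])
    show "cone_facet P v \<inter> rel_interior F \<noteq> {}"
      using y v \<open>y \<in> dual_cone P\<close> by (auto simp: cone_facet_def)
  qed (rule face_of_imp_subset[OF face])
  then have "F face_of cone_facet P v"
    by (rule face_of_subset[OF face]) (simp add: cone_facet_def)
  moreover have "aff_dim (cone_facet P v) \<le> int CARD('n)"
    unfolding cone_facet_def aff_dim_ell_hom_hyperplane[of v, symmetric] by (intro aff_dim_subset) auto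
  moreover have "convex (cone_facet P v)"
    using cone_facet_face[OF v(1)] by (rule face_of_imp_convex)
  ultimately have "F = cone_facet P v"
    using face_of_aff_dim_lt[of "cone_facet P v" F] dim by auto
  with v that show thesis by blast
qed

text \<open>
  Vertices of polytopes are exposed. This makes every \<open>\<ell>\<^sub>v\<close> irredundant in the description of the dual cone.
\<close>

lemma vertex_exposing_form:
  fixes P :: "(real ^ 'n) set"
  assumes "polytope P" "v \<in> vertices P"
  obtains y :: "real ^ 'n option" where "ell_hom v y = 0" "\<And>u. u \<in> vertices P \<Longrightarrow> u \<noteq> v \<Longrightarrow> 0 < ell_hom u y"
proof -
  have "{v} exposed_face_of P"
    using assms by (simp add: exposed_face_of_polyhedron polytope_imp_polyhedron vertices_def face_of_singleton)
  then obtain a b where ab: "P \<subseteq> {x. a \<bullet> x \<le> b}" "{v} = P \<inter> {x. a \<bullet> x = b}"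
    by (auto simp: exposed_face_of_def)
  define y :: "real ^ 'n option" where "y = (\<chi> j. case j of None \<Rightarrow> b | Some i \<Rightarrow> a $ i)"
  have y: "ell_hom u y = b - a \<bullet> u" for u
    by (simp add: ell_hom_def y_def inner_vec_def mult.commute)
  show thesis
  proof
    have "v \<in> P \<inter> {x. a \<bullet> x = b}" unfolding ab(2)[symmetric] by simp
    then show "ell_hom v y = 0" using y by simp
    fix u assume "u \<in> vertices P" "u \<noteq> v"
    then have "u \<in> P" by (simp add: vertices_def extreme_point_of_def)
    then show "0 < ell_hom u y" using ab \<open>u \<noteq> v\<close> unfolding y by (force simp: less_le)
  qed
qed

lemma cone_facet_facet:
  fixes P :: "(real ^ 'n) set"
  assumes "polytope P" "finite (vertices P)" "v \<in> vertices P"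
  shows "cone_facet P v facet_of dual_cone P"
proof -
  obtain y :: "real ^ 'n option" where y: "ell_hom v y = 0" "\<And>u. u \<in> vertices P \<Longrightarrow> u \<noteq> v \<Longrightarrow> 0 < ell_hom u y"
    using vertex_exposing_form[OF assms(1,3)] by blast
  let ?H = "{y :: real ^ 'n option. ell_hom v y = 0}" and ?O = "{y :: real ^ 'n option. \<forall>u\<in>vertices P - {v}. 0 < ell_hom u y}"
  have "convex ?H" unfolding ell_hom_inner by (rule convex_hyperplane)
  then have "aff_dim (?H \<inter> ?O) = aff_dim ?H"
  proof (rule aff_dim_convex_Int_open)
    show "open ?O" using assms(2) by (intro open_ell_hom_pos) simp
    show "?H \<inter> ?O \<noteq> {}" using y by blast
  qed
  moreover have "aff_dim (?H \<inter> ?O) \<le> aff_dim (cone_facet P v)"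
  proof (rule aff_dim_subset, rule subsetI)
    fix z assume z: "z \<in> ?H \<inter> ?O"
    have "0 \<le> ell_hom u z" if "u \<in> vertices P" for u
      using z that by (cases "u = v") (auto simp: less_imp_le)
    then show "z \<in> cone_facet P v" using z by (simp add: cone_facet_def dual_cone_def)
  qed
  moreover have "aff_dim (cone_facet P v) \<le> aff_dim ?H"
    by (intro aff_dim_subset) (auto simp: cone_facet_def)
  ultimately have "aff_dim (cone_facet P v) = int CARD('n)"
    by (simp add: aff_dim_ell_hom_hyperplane)
  then show ?thesis
    using cone_facet_face[OF assms(3)] aff_dim_dual_cone[OF assms(2)]
    by (auto simp: facet_of_def)
qed

lemma ell_hom_complexify: "ell_hom v (complexify y) = complex_of_real (ell_hom v y)"
  by (simp add: ell_hom_def complexify_def)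

lemma complexify_linear:
  "complexify (y + z) = complexify y + complexify z"
  "complexify (c *\<^sub>R y) = complex_of_real c *s complexify y"
  "complexify 0 = 0"
  by (simp_all add: complexify_def vec_eq_iff)

lemma complexify_eq_0_iff: "complexify y = 0 \<longleftrightarrow> y = 0"
  by (simp add: complexify_def vec_eq_iff)

lemma zariski_closure_extensive: "0 \<notin> S \<Longrightarrow> S \<subseteq> zariski_closure S"
  by (auto simp: zariski_closure_def zero_locus_def)

lemma zariski_closure_subset_zero_locus:
  "homogeneous_poly k f \<Longrightarrow> S \<subseteq> zero_locus f \<Longrightarrow> zariski_closure S \<subseteq> zero_locus f"
  by (auto simp: zariski_closure_def zero_locus_def)

lemma complexify_in_proj_closure: "y \<in> F \<Longrightarrow> y \<noteq> 0 \<Longrightarrow> complexify y \<in> proj_closure F"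
  unfolding proj_closure_def
  by (rule subsetD[OF zariski_closure_extensive]) (auto simp: complexify_eq_0_iff)

lemma proj_closure_subset_polar_hyperplane:
  assumes "\<And>y. y \<in> F \<Longrightarrow> ell_hom v y = 0"
  shows "proj_closure F \<subseteq> polar_hyperplane v"
  unfolding proj_closure_def polar_hyperplane_def
  by (rule zariski_closure_subset_zero_locus[OF homogeneous_poly_ell_hom])
     (auto simp: zero_locus_def complexify_eq_0_iff ell_hom_complexify assms)

text \<open>
  A facet spans its hyperplane over the reals, and a complex vector in a hyperplane with real equation has
  its real and imaginary parts in the real hyperplane.
\<close>

lemma span_proj_closure_cone_facet:
  fixes P :: "(real ^ 'n) set"
  assumes "polytope P" "finite (vertices P)" "v \<in> vertices P"
  shows "vec.span (proj_closure (cone_facet P v)) - {0} = polar_hyperplane v"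
proof
  let ?F = "cone_facet P v" and ?H = "{y :: real ^ 'n option. ell_hom v y = 0}"
  let ?S = "vec.span (proj_closure ?F)"
  have "vec.subspace {x :: complex ^ 'n option. ell_hom v x = 0}"
    by (auto simp: vec.subspace_def ell_hom_right_linear)
  then have "?S \<subseteq> {x. ell_hom v x = 0}"
    using proj_closure_subset_polar_hyperplane[of ?F v]
    by (intro vec.span_minimal) (auto simp: cone_facet_def polar_hyperplane_def zero_locus_def)
  then show "?S - {0} \<subseteq> polar_hyperplane v"
    by (auto simp: polar_hyperplane_def zero_locus_def)
  have "0 \<in> ?F" by (simp add: cone_facet_def dual_cone_def ell_hom_right_linear)
  have "subspace ?H" by (auto simp: subspace_def ell_hom_right_linear ell_hom_scaleR)
  have "aff_dim ?F = int CARD('n)"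
    using cone_facet_facet[OF assms] aff_dim_dual_cone[OF assms(2)] by (simp add: facet_of_def)
  then have "dim ?F = dim ?H"
    using aff_dim_zero[of ?F] aff_dim_zero[of ?H] \<open>0 \<in> ?F\<close>
    by (simp add: aff_dim_ell_hom_hyperplane hull_inc ell_hom_right_linear)
  moreover have "?F \<subseteq> ?H" by (auto simp: cone_facet_def)
  ultimately have "span ?F = ?H"
    using \<open>subspace ?H\<close> by (metis dim_eq_span order_refl span_eq_iff)
  have real: "complexify y \<in> ?S" if "ell_hom v y = 0" for y
  proof -
    have "y \<in> span ?F" using that \<open>span ?F = ?H\<close> by simp
    then show ?thesis
    proof (induction rule: span_induct_alt)
      case base
      then show ?case by (simp add: complexify_linear vec.span_zero)
    next
      case (step c y z)
      have "complexify y \<in> ?S"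
      proof (cases "y = 0")
        case True
        then show ?thesis unfolding True complexify_linear(3) by (intro vec.span_zero)
      qed (use step(1) complexify_in_proj_closure[of y ?F] in \<open>auto intro: vec.span_base\<close>)
      then show ?case
        using step(2) by (simp add: complexify_linear vec.span_add vec.span_scale)
    qed
  qed
  show "polar_hyperplane v \<subseteq> ?S - {0}"
  proof
    fix x :: "complex ^ 'n option" assume "x \<in> polar_hyperplane v"
    then have x: "x \<noteq> 0" "ell_hom v x = 0" by (auto simp: polar_hyperplane_def zero_locus_def)
    define y z :: "real ^ 'n option" where "y = (\<chi> i. Re (x $ i))" and "z = (\<chi> i. Im (x $ i))"
    have "x = complexify y + \<i> *s complexify z"
      by (simp add: vec_eq_iff y_def z_def complexify_def complex_eq)
    moreover have "ell_hom v y = Re (ell_hom v x)" "ell_hom v z = Im (ell_hom v x)"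
      by (simp_all add: ell_hom_def y_def z_def)
    ultimately show "x \<in> ?S - {0}"
      using x real[of y] real[of z] by (simp add: vec.span_add vec.span_scale)
  qed
qed

section \<open>The residual arrangement of the dual cone\<close>

lemma facet_arrangement_dual_cone:
  fixes P :: "(real ^ 'n) set"
  assumes "polytope P" "finite (vertices P)"
  shows "facet_arrangement (dual_cone P) = polar_hyperplane ` vertices P"
    and "{F. F facet_of dual_cone P} = cone_facet P ` vertices P"
proof -
  show *: "{F. F facet_of dual_cone P} = cone_facet P ` vertices P"
    using cone_facet_facet[OF assms] facet_of_dual_cone_imp[OF assms(2)] by blast
  have "facet_arrangement (dual_cone P) = (\<lambda>F. vec.span (proj_closure F) - {0}) ` {F. F facet_of dual_cone P}"
    by (auto simp: facet_arrangement_def)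
  also have "\<dots> = polar_hyperplane ` vertices P"
    unfolding * image_image using span_proj_closure_cone_facet[OF assms] by (intro image_cong) auto
  finally show "facet_arrangement (dual_cone P) = polar_hyperplane ` vertices P" .
qed

lemma vertex_hyperplanes_distinct:
  fixes P :: "(real ^ 'n) set"
  assumes "polytope P" "finite (vertices P)"
  shows "inj_on (cone_facet P) (vertices P)" "inj_on polar_hyperplane (vertices P)"
proof -
  have *: "cone_facet P v \<noteq> cone_facet P u \<and> polar_hyperplane v \<noteq> polar_hyperplane u"
    if "v \<in> vertices P" "u \<in> vertices P" "u \<noteq> v" for v u
  proof -
    obtain y :: "real ^ 'n option" where y: "ell_hom v y = 0" "\<And>u. u \<in> vertices P \<Longrightarrow> u \<noteq> v \<Longrightarrow> 0 < ell_hom u y"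
      using vertex_exposing_form[OF assms(1) \<open>v \<in> vertices P\<close>] by blast
    have u: "0 < ell_hom u y" using y that by blast
    have "0 \<le> ell_hom w y" if "w \<in> vertices P" for w
      using y that by (cases "w = v") (auto simp: less_imp_le)
    then have "y \<in> cone_facet P v" "y \<notin> cone_facet P u"
      using u y by (auto simp: cone_facet_def dual_cone_def)
    moreover have "complexify y \<in> polar_hyperplane v" "complexify y \<notin> polar_hyperplane u"
      using u y by (auto simp: polar_hyperplane_def zero_locus_def ell_hom_complexify complexify_eq_0_iff ell_hom_right_linear)
    ultimately show ?thesis by blast
  qed
  show "inj_on (cone_facet P) (vertices P)" "inj_on polar_hyperplane (vertices P)"
    using * by (auto intro!: inj_onI)
qed

text \<open>
  If \<open>L\<close> is the intersection of the hyperplanes of the vertices in \<open>W\<close>, then the face of the dual cone where the forms of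
  \<open>W\<close> vanish has its projective closure inside \<open>L\<close>. As \<open>L\<close> is residual, this face is \<open>{0}\<close>.
\<close>

lemma residual_arrangement_point:
  fixes P :: "(real ^ 'n) set"
  assumes "polytope P" "finite (vertices P)"
    and L: "L \<in> residual_arrangement (dual_cone P)" "x \<in> L"
  shows "x \<noteq> 0"
    and "\<And>y. y \<in> dual_cone P \<Longrightarrow> (\<And>v. v \<in> vertices P \<Longrightarrow> ell_hom v x = 0 \<Longrightarrow> ell_hom v y = 0) \<Longrightarrow> y = 0"
proof -
  let ?C = "dual_cone P"
  obtain S where S: "L = \<Inter>S" "S \<subseteq> polar_hyperplane ` vertices P" "\<And>F. F \<in> proj_faces ?C \<Longrightarrow> \<not> F \<subseteq> \<Inter>S"
    using L(1) facet_arrangement_dual_cone(1)[OF assms(1,2)] by (auto simp: residual_arrangement_def)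
  \<comment> \<open>The empty intersection is everything, including the vector \<open>0\<close>; it is not residual, because it contains the whole polytope.\<close>
  have "S \<noteq> {}"
  proof
    assume "S = {}"
    have "?C face_of ?C" by (simp add: face_of_refl convex_dual_cone)
    moreover have "aff_dim ?C \<noteq> -1" "aff_dim ?C \<noteq> 0"
      unfolding aff_dim_dual_cone[OF assms(2)] by simp_all
    then have "?C \<noteq> {}" "?C \<noteq> {0}" by (metis aff_dim_empty, metis aff_dim_sing)
    ultimately have "proj_closure ?C \<in> proj_faces ?C" by (auto simp: proj_faces_def)
    then show False using S(3) \<open>S = {}\<close> by auto
  qed
  then show "x \<noteq> 0" using L(2) S(1,2) by (force simp: polar_hyperplane_def zero_locus_def)
  fix y assume y: "y \<in> ?C" "\<And>v. v \<in> vertices P \<Longrightarrow> ell_hom v x = 0 \<Longrightarrow> ell_hom v y = 0"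
  show "y = 0"
  proof (rule ccontr)
    assume "y \<noteq> 0"
    obtain W where W: "W \<subseteq> vertices P" "S = polar_hyperplane ` W"
      using S(2) by (auto simp: subset_image_iff)
    then have "W \<noteq> {}" using \<open>S \<noteq> {}\<close> by auto
    have xW: "ell_hom v x = 0" if "v \<in> W" for v
      using L(2) S(1) W(2) that by (auto simp: polar_hyperplane_def zero_locus_def)
    define F where "F = (\<Inter>v\<in>W. cone_facet P v)"
    have "F face_of ?C"
      unfolding F_def using \<open>W \<noteq> {}\<close> W(1) cone_facet_face by (intro face_of_Inter) auto
    moreover have "y \<in> F"
      using y W(1) xW by (auto simp: F_def cone_facet_def)
    ultimately have "proj_closure F \<in> proj_faces ?C"
      using \<open>y \<noteq> 0\<close> by (auto simp: proj_faces_def)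
    moreover have "proj_closure F \<subseteq> \<Inter>S"
      unfolding W(2)
    proof (intro INT_greatest)
      fix v assume "v \<in> W"
      then have "F \<subseteq> cone_facet P v" unfolding F_def by blast
      then show "proj_closure F \<subseteq> polar_hyperplane v"
        by (intro proj_closure_subset_polar_hyperplane) (auto simp: cone_facet_def)
    qed
    ultimately show False using S(3) by blast
  qed
qed

lemma residual_arrangementI:
  fixes P :: "(real ^ 'n) set"
  assumes "polytope P" "finite (vertices P)" "J \<subseteq> vertices P"
    and infeasible: "\<And>y. y \<in> dual_cone P \<Longrightarrow> (\<And>v. v \<in> J \<Longrightarrow> ell_hom v y = 0) \<Longrightarrow> y = 0"
  shows "\<Inter>(polar_hyperplane ` J) \<in> residual_arrangement (dual_cone P)"
proof -
  have "\<not> G \<subseteq> \<Inter>(polar_hyperplane ` J)" if "G \<in> proj_faces (dual_cone P)" for G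
  proof
    assume sub: "G \<subseteq> \<Inter>(polar_hyperplane ` J)"
    obtain F where F: "G = proj_closure F" "F face_of dual_cone P" "F \<noteq> {}" "F \<noteq> {0}"
      using \<open>G \<in> _\<close> by (auto simp: proj_faces_def)
    then obtain y where y: "y \<in> F" "y \<noteq> 0" by blast
    then have "complexify y \<in> \<Inter>(polar_hyperplane ` J)"
      using F(1) sub complexify_in_proj_closure by blast
    then have "ell_hom v y = 0" if "v \<in> J" for v
      using that by (auto simp: polar_hyperplane_def zero_locus_def ell_hom_complexify)
    then show False
      using infeasible[of y] y face_of_imp_subset[OF F(2)] by blast
  qed
  then show ?thesis
    using assms(3) facet_arrangement_dual_cone(1)[OF assms(1,2)] by (auto simp: residual_arrangement_def)
qed

section \<open>Forms vanishing on the residual arrangement of a general configuration\<close>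

text \<open>
  A vector space over an infinite field is not a finite union of proper subspaces.
\<close>

lemma exists_point_off_hyperplanes:
  fixes G :: "(complex ^ 'm \<Rightarrow> complex) set"
  assumes "finite G" "vec.subspace U"
    and lin: "\<And>g x c y. g \<in> G \<Longrightarrow> g (x + c *s y) = g x + c * g y"
    and ne: "\<And>g. g \<in> G \<Longrightarrow> \<exists>r\<in>U. g r \<noteq> 0"
  shows "\<exists>r\<in>U. \<forall>g\<in>G. g r \<noteq> 0"
  using assms(1) lin ne
proof (induction G)
  case empty
  then show ?case using vec.subspace_0[OF assms(2)] by blast
next
  case (insert g G)
  then obtain r where r: "r \<in> U" "\<forall>h\<in>G. h r \<noteq> 0" by blast
  obtain s where s: "s \<in> U" "g s \<noteq> 0" using insert by blast
  show ?case
  proof (cases "g r = 0")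
    case True
    have "finite (insert 0 ((\<lambda>h. - h r / h s) ` G))"
      using insert by simp
    then obtain t where t: "t \<notin> insert 0 ((\<lambda>h. - h r / h s) ` G)"
      using ex_new_if_finite[OF infinite_UNIV_char_0] by blast
    have "h (r + t *s s) \<noteq> 0" if "h \<in> insert g G" for h
    proof (cases "h = g")
      case True
      then show ?thesis using \<open>g r = 0\<close> s t insert.prems(1)[of g] by simp
    next
      case False
      then have "h r \<noteq> 0" "h s \<noteq> 0 \<Longrightarrow> t \<noteq> - h r / h s" using that r t by auto
      then have "h r + t * h s \<noteq> 0"
        by (cases "h s = 0") (auto simp: field_simps eq_neg_iff_add_eq_0 add.commute)
      then show ?thesis using insert.prems(1)[OF that] by simp
    qed
    moreover have "r + t *s s \<in> U"
      using assms(2) r s by (simp add: vec.subspace_add vec.subspace_scale)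
    ultimately show ?thesis by blast
  qed (use r in auto)
qed

text \<open>
  The hyperplane arrangement of the forms \<open>\<ell>\<^sub>v\<close>, \<open>v \<in> V\<close>, is simple: the linear space cut out by the forms of
  \<open>J \<subseteq> V\<close> has codimension \<open>card J\<close> as long as \<open>card J \<le> n + 1\<close>.
\<close>

locale general_position =
  fixes V :: "(real ^ 'n) set"
  assumes finV: "finite V" and cardV: "CARD('n) < card V"
    and general: "\<And>x :: complex ^ 'n option. x \<noteq> 0 \<Longrightarrow> card {v \<in> V. ell_hom v x = 0} \<le> CARD('n)"
begin

lemma zero_if_many_zeros:
  fixes x :: "complex ^ 'n option"
  assumes "K \<subseteq> V" "CARD('n) < card K" "\<And>v. v \<in> K \<Longrightarrow> ell_hom v x = 0"
  shows "x = 0"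
proof (rule ccontr)
  assume "x \<noteq> 0"
  have "card K \<le> card {v \<in> V. ell_hom v x = 0}"
    using assms finV by (intro card_mono) auto
  then show False using general[OF \<open>x \<noteq> 0\<close>] assms(2) by simp
qed

lemma real_zero_if_many_zeros:
  fixes y :: "real ^ 'n option"
  assumes "K \<subseteq> V" "CARD('n) < card K" "\<And>v. v \<in> K \<Longrightarrow> ell_hom v y = 0"
  shows "y = 0"
  using zero_if_many_zeros[OF assms(1,2), of "complexify y"] assms(3)
  by (simp add: ell_hom_complexify complexify_eq_0_iff)

text \<open>
  Any \<open>n + 1\<close> of the forms are coordinates, since an injective endomorphism of a finite-dimensional space is onto.
\<close>

lemma interpolation:
  assumes "K \<subseteq> V" "card K \<le> Suc CARD('n)"
  obtains x :: "complex ^ 'n option" where "\<And>v. v \<in> K \<Longrightarrow> ell_hom v x = c v"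
proof -
  obtain M where M: "K \<subseteq> M" "M \<subseteq> V" "card M = Suc CARD('n)"
    using exists_subset_between[of K "Suc CARD('n)" V] assms finV cardV by auto
  then have "finite M" using finV finite_subset by blast
  then obtain e :: "'n option \<Rightarrow> real ^ 'n" where e: "bij_betw e UNIV M"
    using finite_same_card_bij[of "UNIV :: 'n option set" M] M(3) by (auto simp: card_UNIV_option)
  define g :: "complex ^ 'n option \<Rightarrow> complex ^ 'n option" where "g x = (\<chi> i. ell_hom (e i) x)" for x
  have lin: "Vector_Spaces.linear (*s) (*s) g"
    unfolding Vector_Spaces.linear_iff
    by (simp add: g_def vec_eq_iff ell_hom_right_linear vec.vector_space_axioms)
  have "inj g"
  proof (subst vec.linear_inj_iff_eq_0[OF lin], intro allI impI)
    fix x assume "g x = 0"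
    then have z: "ell_hom (e i) x = 0" for i by (simp add: g_def vec_eq_iff)
    have "ell_hom v x = 0" if v: "v \<in> M" for v
    proof -
      have "v \<in> e ` UNIV" using v e by (simp add: bij_betw_imp_surj_on)
      then show ?thesis using z by blast
    qed
    then show "x = 0"
      using zero_if_many_zeros[OF M(2)] M(3) by simp
  qed
  then have "surj g" using vec.linear_inj_imp_surj[OF lin] by simp
  then obtain x where "g x = (\<chi> i. c (e i))" by (metis surjD)
  then have x: "ell_hom (e i) x = c (e i)" for i by (simp add: g_def vec_eq_iff)
  have "ell_hom v x = c v" if "v \<in> K" for v
  proof -
    have "v \<in> e ` UNIV" using that M(1) e by (auto simp: bij_betw_imp_surj_on)
    then show ?thesis using x by blast
  qed
  then show thesis using that by blast
qed

lemma real_interpolation: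
  assumes "K \<subseteq> V" "card K \<le> Suc CARD('n)"
  obtains y :: "real ^ 'n option" where "\<And>v. v \<in> K \<Longrightarrow> ell_hom v y = c v"
proof -
  obtain x :: "complex ^ 'n option" where x: "\<And>v. v \<in> K \<Longrightarrow> ell_hom v x = of_real (c v)"
    using interpolation[OF assms, of "\<lambda>v. of_real (c v)"] by blast
  have "ell_hom v (\<chi> i. Re (x $ i)) = Re (ell_hom v x)" for v
    by (simp add: ell_hom_def)
  then show thesis using that[of "\<chi> i. Re (x $ i)"] x by simp
qed

definition vanishes_on :: "(complex ^ 'n option \<Rightarrow> complex) \<Rightarrow> (real ^ 'n) set \<Rightarrow> bool" where
  "vanishes_on f J \<longleftrightarrow> (\<forall>x. x \<noteq> 0 \<longrightarrow> (\<forall>v\<in>J. ell_hom v x = 0) \<longrightarrow> f x = 0)"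

lemma vanishes_on_mono: "vanishes_on f J \<Longrightarrow> J \<subseteq> I \<Longrightarrow> vanishes_on f I"
  by (auto simp: vanishes_on_def)

text \<open>
  The intersection of the space of \<open>J\<close> with the other hyperplanes gives at least \<open>d - card J - 1\<close> sections
  where \<open>f\<close> is known to vanish, which exceeds the degree of \<open>f\<close>. On a line through a given
  point in a generic direction the sections are hit at different points, so \<open>f\<close> is zero on the line. One section,
  that of \<open>i\<close>, may be left out: in the induction along edges this is the end of the edge at which
  nothing is known yet.
\<close>

lemma vanishes_on_from_hyperplane_sections:
  assumes f: "homogeneous_poly (card V - CARD('n option)) f"
    and J: "J \<subseteq> V" "card J < CARD('n)"
    and sections: "\<And>j. j \<in> V - J - {i} \<Longrightarrow> vanishes_on f (insert j J)"
  shows "vanishes_on f J"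
  unfolding vanishes_on_def
proof (intro allI impI)
  fix x :: "complex ^ 'n option" assume x: "x \<noteq> 0" "\<forall>v\<in>J. ell_hom v x = 0"
  have finJ: "finite J" using J finV finite_subset by blast
  have cVJ: "card (V - J) = card V - card J" using finJ J by (simp add: card_Diff_subset)
  show "f x = 0"
  proof (cases "\<exists>j\<in>V - J - {i}. ell_hom j x = 0")
    case True
    then show ?thesis using sections x unfolding vanishes_on_def by fastforce
  next
    case False
    let ?U = "{r :: complex ^ 'n option. \<forall>v\<in>J. ell_hom v r = 0}"
    \<comment> \<open>\<open>D (j, j') r \<noteq> 0\<close> prevents the line through \<open>x\<close> with direction \<open>r\<close> from meeting the sections of \<open>j\<close> and \<open>j'\<close> at the same point.\<close>
    define D where "D = (\<lambda>(j, j') r. ell_hom j x * ell_hom j' r - ell_hom j' x * ell_hom j r)"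
    define pairs where "pairs = {(j, j'). j \<in> V - J \<and> j' \<in> V - J \<and> j \<noteq> j'}"
    have K: "insert j (insert j' J) \<subseteq> V" "card (insert j (insert j' J)) \<le> Suc CARD('n)"
      if "j \<in> V" "j' \<in> V" for j j'
      using that J finJ by (auto simp: card_insert_if)
    have "\<exists>r\<in>?U. \<forall>g\<in>D ` pairs \<union> ell_hom ` (V - J). g r \<noteq> 0"
    proof (rule exists_point_off_hyperplanes)
      have "pairs \<subseteq> V \<times> V" by (auto simp: pairs_def)
      then show "finite (D ` pairs \<union> ell_hom ` (V - J))"
        using finV finite_subset[of pairs "V \<times> V"] by auto
      show "vec.subspace ?U" by (auto simp: vec.subspace_def ell_hom_right_linear)
      show "g (p + c *s q) = g p + c * g q" if "g \<in> D ` pairs \<union> ell_hom ` (V - J)" for g p c q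
        using that by (auto simp: D_def ell_hom_right_linear algebra_simps)
      show "\<exists>r\<in>?U. g r \<noteq> 0" if "g \<in> D ` pairs \<union> ell_hom ` (V - J)" for g
        using that
      proof
        assume "g \<in> ell_hom ` (V - J)"
        then obtain j where j: "j \<in> V - J" "g = ell_hom j" by blast
        obtain r :: "complex ^ 'n option" where "\<And>v. v \<in> insert j (insert j J) \<Longrightarrow> ell_hom v r = (if v = j then 1 else 0)"
          using interpolation[OF K, of j j "\<lambda>v. if v = j then 1 else 0"] j by blast
        then show ?thesis using j by (intro bexI[of _ r]) auto
      next
        assume "g \<in> D ` pairs"
        then obtain j j' where j: "j \<in> V - J" "j' \<in> V - J" "j \<noteq> j'" "g = D (j, j')" 
          by (auto simp: pairs_def)
        then have "ell_hom j x \<noteq> 0 \<or> ell_hom j' x \<noteq> 0" using False by auto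
        then obtain k l where kl: "{j, j'} = {k, l}" "k \<noteq> l" "ell_hom k x \<noteq> 0" using j by blast
        obtain r :: "complex ^ 'n option" where "\<And>v. v \<in> insert j (insert j' J) \<Longrightarrow> ell_hom v r = (if v = l then 1 else 0)"
          using interpolation[OF K, of j j' "\<lambda>v. if v = l then 1 else 0"] j by blast
        then have "r \<in> ?U" "g r \<noteq> 0"
          using kl j by (auto simp: D_def doubleton_eq_iff)
        then show ?thesis by blast
      qed
    qed
    then obtain r where rU: "r \<in> ?U" and G: "\<And>g. g \<in> D ` pairs \<union> ell_hom ` (V - J) \<Longrightarrow> g r \<noteq> 0"
      by blast
    have r: "\<And>v. v \<in> J \<Longrightarrow> ell_hom v r = 0" "\<And>j. j \<in> V - J \<Longrightarrow> ell_hom j r \<noteq> 0"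
      using rU G by blast+
    have D: "ell_hom j x * ell_hom j' r \<noteq> ell_hom j' x * ell_hom j r"
      if "j \<in> V - J" "j' \<in> V - J" "j \<noteq> j'" for j j'
    proof -
      have "D (j, j') \<in> D ` pairs" using that by (simp add: pairs_def)
      then have "D (j, j') r \<noteq> 0" using G by blast
      then show ?thesis by (simp add: D_def)
    qed
    obtain q where q: "degree q \<le> card V - CARD('n option)" "\<And>t. f (x + t *s r) = poly q t"
      using homogeneous_poly_on_line[OF f] by blast
    define t where "t j = - (ell_hom j x / ell_hom j r)" for j
    have inj: "inj_on t (V - J - {i})"
    proof (rule inj_onI, rule ccontr)
      fix j j' assume j: "j \<in> V - J - {i}" "j' \<in> V - J - {i}" "t j = t j'" "j \<noteq> j'"
      then have "ell_hom j x * ell_hom j' r = ell_hom j' x * ell_hom j r"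
        using r(2)[of j] r(2)[of j'] by (simp add: t_def frac_eq_eq)
      then show False using D j by blast
    qed
    have root: "poly q (t j) = 0" if j: "j \<in> V - J - {i}" for j
    proof -
      let ?z = "x + t j *s r"
      have "ell_hom v ?z = 0" if "v \<in> insert j J" for v
        using that r j x(2) by (auto simp: ell_hom_right_linear t_def)
      moreover have "?z \<noteq> 0"
      proof
        assume z: "?z = 0"
        have "card (V - J - {j}) > 0"
          using cVJ j J cardV finV by (simp add: card_Diff_singleton)
        then obtain j' where j': "j' \<in> V - J" "j' \<noteq> j" by (metis Diff_iff card_gt_0_iff ex_in_conv singletonI)
        have "ell_hom w x = - (t j * ell_hom w r)" for w
        proof -
          have "ell_hom w ?z = 0" using z by (simp add: ell_hom_right_linear)
          then show ?thesis by (simp add: ell_hom_right_linear eq_neg_iff_add_eq_0)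
        qed
        then have "ell_hom j x * ell_hom j' r = ell_hom j' x * ell_hom j r" by simp
        then show False using D j j' by blast
      qed
      ultimately have "f ?z = 0"
        using sections[OF j] unfolding vanishes_on_def by blast
      then show ?thesis using q(2) by simp
    qed
    have "q = 0"
    proof (rule ccontr)
      assume "q \<noteq> 0"
      have "card (V - J - {i}) = card (t ` (V - J - {i}))" using inj by (simp add: card_image)
      also have "\<dots> \<le> card {z. poly q z = 0}"
        using root \<open>q \<noteq> 0\<close> by (intro card_mono poly_roots_finite) auto
      also have "\<dots> \<le> card V - CARD('n option)"
        using card_poly_roots_bound[OF \<open>q \<noteq> 0\<close>] q(1) by linarith
      finally have "card (V - J - {i}) \<le> card V - CARD('n option)" .
      moreover have "card (V - J) - 1 \<le> card (V - J - {i})"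
        by (simp add: card_Diff_singleton_if)
      ultimately show False
        using cVJ J cardV by (simp add: card_UNIV_option)
    qed
    then show ?thesis using q(2)[of 0] by simp
  qed
qed

lemma zero_if_vanishes_on_points:
  assumes f: "homogeneous_poly (card V - CARD('n option)) f"
    and points: "\<And>I. I \<subseteq> V \<Longrightarrow> card I = CARD('n) \<Longrightarrow> vanishes_on f I"
  shows "vanishes_on f {}"
proof -
  have "\<forall>J\<subseteq>V. card J = m \<longrightarrow> vanishes_on f J" if "m \<le> CARD('n)" for m
    using that
  proof (induction rule: inc_induct)
    case base
    show ?case using points by blast
  next
    case (step m)
    show ?case
    proof (intro allI impI)
      fix J assume J: "J \<subseteq> V" "card J = m"
      then have "finite J" using finV finite_subset by blast
      then show "vanishes_on f J"
        using J step by (intro vanishes_on_from_hyperplane_sections[OF f J(1)]) auto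
    qed
  qed
  from this[of 0] show ?thesis by simp
qed

definition positive_cone :: "(real ^ 'n option) set" where
  "positive_cone = {y. \<forall>v\<in>V. 0 \<le> ell_hom v y}"

text \<open>
  The sum over all of \<open>V\<close> is positive on the cone without the origin and serves to normalize cone points to a compact slice;
  the sum over the forms of one vertex is minimal on the slice exactly at this vertex.
\<close>

definition form_sum :: "(real ^ 'n) set \<Rightarrow> real ^ 'n option \<Rightarrow> real" where
  "form_sum W y = (\<Sum>v\<in>W. ell_hom v y)"

lemma linear_ell_hom: "linear (ell_hom v :: real ^ 'n option \<Rightarrow> real)"
  by (intro linearI) (simp_all add: ell_hom_right_linear ell_hom_scaleR)

lemma linear_form_sum: "linear (form_sum W)"
  by (intro linearI)
     (simp_all add: form_sum_def ell_hom_right_linear ell_hom_scaleR sum.distrib sum_distrib_left)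

lemma form_sum_pos:
  assumes "y \<in> positive_cone" "W \<subseteq> V" "w \<in> W" "ell_hom w y \<noteq> 0"
  shows "0 < form_sum W y"
  unfolding form_sum_def
proof (rule sum_pos2)
  show "finite W" using assms(2) finV finite_subset by blast
  show "0 < ell_hom w y" using assms by (auto simp: positive_cone_def less_le)
qed (use assms in \<open>auto simp: positive_cone_def\<close>)

lemma form_sum_V_pos:
  assumes "y \<in> positive_cone" "y \<noteq> 0"
  shows "0 < form_sum V y"
proof -
  obtain w where "w \<in> V" "ell_hom w y \<noteq> 0"
    using real_zero_if_many_zeros[of V y] cardV assms(2) by auto
  then show ?thesis using form_sum_pos[OF assms(1)] by blast
qed

lemma nonzero_off_vertex:
  fixes y :: "real ^ 'n option"
  assumes "I \<subseteq> V" "card I = CARD('n)" "\<And>v. v \<in> I \<Longrightarrow> ell_hom v y = 0" "y \<noteq> 0" "k \<in> V - I"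
  shows "ell_hom k y \<noteq> 0"
proof
  assume "ell_hom k y = 0"
  moreover have "finite I" using assms(1) finV finite_subset by blast
  ultimately have "y = 0"
    using assms by (intro real_zero_if_many_zeros[of "insert k I"]) auto
  with assms(4) show False by simp
qed

text \<open>
  The forms in \<open>I\<close> cut out a line through the origin; on this line only the origin is mapped to \<open>0\<close> by the
  normalizing functional.
\<close>

lemma zero_on_vertex_line:
  assumes I: "I \<subseteq> V" "card I = CARD('n)"
    and y: "form_sum V y \<noteq> 0" "\<And>v. v \<in> I \<Longrightarrow> ell_hom v y = 0"
    and z: "form_sum V z = 0" "\<And>v. v \<in> I \<Longrightarrow> ell_hom v z = 0"
  shows "z = 0"
proof -
  have "y \<noteq> 0" using y(1) linear_0[OF linear_form_sum] by metis
  have fin: "finite I" using I finV finite_subset by blast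
  have "V - I \<noteq> {}" using I cardV fin by (metis card_mono finV Diff_eq_empty_iff not_le)
  then obtain k where k: "k \<in> V - I" by blast
  have ky: "ell_hom k y \<noteq> 0" using nonzero_off_vertex[OF I y(2) \<open>y \<noteq> 0\<close> k] by simp
  define c where "c = ell_hom k z / ell_hom k y"
  have "z - c *\<^sub>R y = 0"
    using I fin k ky y(2) z(2)
    by (intro real_zero_if_many_zeros[of "insert k I"])
       (auto simp: ell_hom_right_linear ell_hom_scaleR c_def)
  then have "z = c *\<^sub>R y" by simp
  then have "c * form_sum V y = 0"
    using z(1) linear_scale[OF linear_form_sum, of V c y] by simp
  then show ?thesis using y(1) \<open>z = c *\<^sub>R y\<close> by simp
qed

text \<open>
  No nonempty face of the polytope lies in the linear space cut out by \<open>J\<close>, which is therefore residual.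
\<close>

definition infeasible :: "(real ^ 'n) set \<Rightarrow> bool" where
  "infeasible J \<longleftrightarrow> (\<forall>y\<in>positive_cone. (\<forall>v\<in>J. ell_hom v y = 0) \<longrightarrow> y = 0)"

lemma feasible_point:
  assumes "\<not> infeasible I"
  shows "\<exists>y. y \<in> positive_cone \<and> form_sum V y = 1 \<and> (\<forall>v\<in>I. ell_hom v y = 0)"
proof -
  obtain y where y: "y \<in> positive_cone" "\<forall>v\<in>I. ell_hom v y = 0" "y \<noteq> 0"
    using assms by (auto simp: infeasible_def)
  define e where "e = form_sum V y"
  have "e > 0" using form_sum_V_pos y by (simp add: e_def)
  have "form_sum V ((1 / e) *\<^sub>R y) = 1"
    using \<open>e > 0\<close> linear_scale[OF linear_form_sum, of V "1 / e" y] by (simp add: e_def)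
  moreover have "(1 / e) *\<^sub>R y \<in> positive_cone" "\<forall>v\<in>I. ell_hom v ((1 / e) *\<^sub>R y) = 0"
    using y \<open>e > 0\<close> by (auto simp: positive_cone_def ell_hom_scaleR)
  ultimately show ?thesis by blast
qed

text \<open>
  The direction, within the normalized slice, of the edge at the vertex \<open>y\<close> leaving the facet of \<open>i\<close>.
\<close>

lemma edge_direction:
  assumes I: "I \<subseteq> V" "card I = CARD('n)" "i \<in> I"
    and y: "form_sum V y = 1" "\<And>v. v \<in> I \<Longrightarrow> ell_hom v y = 0"
  obtains u where "form_sum V u = 0" "\<And>v. v \<in> I \<Longrightarrow> ell_hom v u = (if v = i then 1 else 0)"
proof -
  have "card I \<le> Suc CARD('n)" using I by simp
  then obtain w :: "real ^ 'n option" where w: "\<And>v. v \<in> I \<Longrightarrow> ell_hom v w = (if v = i then 1 else 0)"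
    using real_interpolation[OF I(1), of "\<lambda>v. if v = i then 1 else 0"] by blast
  show thesis
  proof
    show "form_sum V (w - form_sum V w *\<^sub>R y) = 0"
      using y(1) by (simp add: linear_diff[OF linear_form_sum] linear_scale[OF linear_form_sum])
    show "ell_hom v (w - form_sum V w *\<^sub>R y) = (if v = i then 1 else 0)" if "v \<in> I" for v
      using w[OF that] y(2)[OF that] by (simp add: ell_hom_right_linear ell_hom_scaleR)
  qed
qed

text \<open>
  Among the vertices where \<open>f\<close> does not vanish take one, \<open>M\<close>, that minimizes the linear objective
  \<open>form_sum I0\<close>. The cone at \<open>M\<close> is generated by its edge directions and contains the vertex \<open>I0\<close> of smaller
  objective value, so the objective decreases along some edge at \<open>M\<close>. Every arrangement point on the line of
  this edge, other than \<open>M\<close>, is either residual or a vertex of smaller objective value; so \<open>f\<close> vanishes at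
  all of them and hence on the line, contradicting the choice of \<open>M\<close>.
\<close>

lemma vanishes_on_all_vertices:
  assumes f: "homogeneous_poly (card V - CARD('n option)) f"
    and residual: "\<And>J. J \<subseteq> V \<Longrightarrow> infeasible J \<Longrightarrow> vanishes_on f J"
    and I0: "I0 \<subseteq> V" "card I0 = CARD('n)" "\<not> infeasible I0" "vanishes_on f I0"
    and I: "I \<subseteq> V" "card I = CARD('n)"
  shows "vanishes_on f I"
proof (rule ccontr)
  define bad where "bad = {I. I \<subseteq> V \<and> card I = CARD('n) \<and> \<not> vanishes_on f I}"
  define pt where "pt I = (SOME y. y \<in> positive_cone \<and> form_sum V y = 1 \<and> (\<forall>v\<in>I. ell_hom v y = 0))" for I
  have pt: "pt I \<in> positive_cone" "form_sum V (pt I) = 1" "\<And>v. v \<in> I \<Longrightarrow> ell_hom v (pt I) = 0"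
    if "\<not> infeasible I" for I
    using someI_ex[OF feasible_point[OF that]] by (simp_all add: pt_def)
  have pt_pos: "0 < ell_hom v (pt I)" if "I \<subseteq> V" "card I = CARD('n)" "\<not> infeasible I" "v \<in> V - I" for v I
  proof -
    have "pt I \<noteq> 0" using pt(2)[OF that(3)] linear_0[OF linear_form_sum] by (metis zero_neq_one)
    then have "ell_hom v (pt I) \<noteq> 0"
      using nonzero_off_vertex[OF that(1,2) pt(3)[OF that(3)]] that(4) by blast
    then show ?thesis using pt(1)[OF that(3)] that(4) by (auto simp: positive_cone_def less_le)
  qed
  assume "\<not> vanishes_on f I"
  then have "bad \<noteq> {}" using I by (auto simp: bad_def)
  moreover have "finite bad"
    unfolding bad_def by (rule finite_subset[of _ "Pow V"]) (use finV in auto)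
  ultimately obtain M where M: "M \<in> bad" "\<And>I. I \<in> bad \<Longrightarrow> form_sum I0 (pt M) \<le> form_sum I0 (pt I)"
    using ex_min_if_finite[of "(\<lambda>I. form_sum I0 (pt I)) ` bad"] by (auto simp: not_less)
  then have MV: "M \<subseteq> V" "card M = CARD('n)" "\<not> vanishes_on f M" by (auto simp: bad_def)
  have finM: "finite M" using MV finV finite_subset by blast
  have Mf: "\<not> infeasible M" using residual MV by blast
  note y = pt[OF Mf] and y0 = pt[OF I0(3)]
  have "M \<noteq> I0" using MV I0 by blast
  then have "I0 - M \<noteq> {}"
    using card_subset_eq[OF finM, of I0] MV I0 by auto
  then obtain w where w: "w \<in> I0" "w \<in> V - M" using I0 by blast
  have \<phi>y: "0 < form_sum I0 (pt M)"
    using form_sum_pos[OF y(1) I0(1) w(1)] pt_pos[OF MV(1,2) Mf w(2)] by simp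
  have \<phi>y0: "form_sum I0 (pt I0) = 0"
    using y0(3) by (simp add: form_sum_def)
  have "\<forall>i\<in>M. \<exists>u. form_sum V u = 0 \<and> (\<forall>v\<in>M. ell_hom v u = (if v = i then 1 else (0::real)))"
  proof
    fix i assume "i \<in> M"
    show "\<exists>u. form_sum V u = 0 \<and> (\<forall>v\<in>M. ell_hom v u = (if v = i then 1 else (0::real)))"
      by (rule edge_direction[OF MV(1,2) \<open>i \<in> M\<close> y(2,3)]) auto
  qed
  then obtain u where u: "\<And>i. i \<in> M \<Longrightarrow> form_sum V (u i) = 0"
    "\<And>i v. i \<in> M \<Longrightarrow> v \<in> M \<Longrightarrow> ell_hom v (u i) = (if v = i then 1 else 0)"
    by metis
  have zero: "z = 0" if "form_sum V z = 0" "\<And>v. v \<in> M \<Longrightarrow> ell_hom v z = 0" for z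
    using zero_on_vertex_line[OF MV(1,2) _ y(3) that] y(2) by simp
  have expand: "z = pt M + (\<Sum>i\<in>M. ell_hom i z *\<^sub>R u i)" if "form_sum V z = 1" for z
  proof -
    have "z - pt M - (\<Sum>i\<in>M. ell_hom i z *\<^sub>R u i) = 0"
    proof (rule zero)
      show "form_sum V (z - pt M - (\<Sum>i\<in>M. ell_hom i z *\<^sub>R u i)) = 0"
        using that y(2) u(1)
        by (simp add: linear_diff[OF linear_form_sum] linear_scale[OF linear_form_sum] linear_sum[OF linear_form_sum])
      fix v assume v: "v \<in> M"
      have "(\<Sum>i\<in>M. ell_hom i z * ell_hom v (u i)) = (\<Sum>i\<in>M. if i = v then ell_hom v z else 0)"
        using u(2) v by (intro sum.cong) auto
      then show "ell_hom v (z - pt M - (\<Sum>i\<in>M. ell_hom i z *\<^sub>R u i)) = 0"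
        using v finM y(3)
        by (simp add: linear_diff[OF linear_ell_hom] linear_scale[OF linear_ell_hom] linear_sum[OF linear_ell_hom])
    qed
    then show ?thesis by (simp add: algebra_simps)
  qed
  have "form_sum I0 (pt I0) = form_sum I0 (pt M) + (\<Sum>i\<in>M. ell_hom i (pt I0) * form_sum I0 (u i))"
    by (subst expand[OF y0(2)])
       (simp add: linear_add[OF linear_form_sum] linear_scale[OF linear_form_sum] linear_sum[OF linear_form_sum])
  then have "(\<Sum>i\<in>M. ell_hom i (pt I0) * form_sum I0 (u i)) < 0"
    using \<phi>y \<phi>y0 by simp
  then obtain i where i: "i \<in> M" "ell_hom i (pt I0) * form_sum I0 (u i) < 0"
    by (meson not_less sum_nonneg)
  have "0 \<le> ell_hom i (pt I0)" using y0(1) i(1) MV(1) by (auto simp: positive_cone_def)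
  then have descent: "form_sum I0 (u i) < 0" using i(2) by (auto simp: mult_less_0_iff)
  have "vanishes_on f (M - {i})"
  proof (rule vanishes_on_from_hyperplane_sections[OF f])
    show "M - {i} \<subseteq> V" "card (M - {i}) < CARD('n)"
      using MV i finM by (auto simp: card_Diff_singleton)
    fix j assume "j \<in> V - (M - {i}) - {i}"
    then have j: "j \<in> V - M" using i by auto
    let ?J = "insert j (M - {i})"
    have J: "?J \<subseteq> V" "card ?J = CARD('n)"
      using MV i finM j by (auto simp: card_Diff_singleton)
    show "vanishes_on f ?J"
    proof (rule ccontr)
      assume *: "\<not> vanishes_on f ?J"
      then have Jf: "\<not> infeasible ?J" using residual J by blast
      note z = pt[OF Jf]
      define s where "s = ell_hom i (pt ?J)"
      \<comment> \<open>The cone point of \<open>?J\<close> is reached from that of \<open>M\<close> by a step of length \<open>s\<close> along the edge.\<close>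
      have "(\<Sum>k\<in>M. ell_hom k (pt ?J) *\<^sub>R u k) = (\<Sum>k\<in>M. if k = i then s *\<^sub>R u i else 0)"
        using z(3) by (intro sum.cong) (auto simp: s_def)
      then have eq: "pt ?J = pt M + s *\<^sub>R u i"
        using expand[OF z(2)] i(1) finM by simp
      have "0 \<le> s" using z(1) MV i by (auto simp: s_def positive_cone_def)
      moreover have "s \<noteq> 0"
        using eq pt_pos[OF MV(1,2) Mf j] z(3)[of j] by auto
      ultimately have "s * form_sum I0 (u i) < 0" using descent by (simp add: mult_less_0_iff)
      moreover have "form_sum I0 (pt ?J) = form_sum I0 (pt M) + s * form_sum I0 (u i)"
        unfolding eq by (simp add: linear_add[OF linear_form_sum] linear_scale[OF linear_form_sum])
      moreover have "?J \<in> bad" using * J by (simp add: bad_def)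
      ultimately show False using M(2)[of ?J] by simp
    qed
  qed
  then have "vanishes_on f M" by (rule vanishes_on_mono) auto
  with MV show False by simp
qed

text \<open>
  The combination \<open>g(p) f - f(p) g\<close> vanishes at the vertex \<open>p\<close>, hence everywhere; and neither \<open>f\<close> nor \<open>g\<close> vanishes at
  \<open>p\<close>, or it would be zero itself.
\<close>

lemma adjoint_form_unique:
  assumes f: "homogeneous_poly (card V - CARD('n option)) f" "f x1 \<noteq> 0"
    and g: "homogeneous_poly (card V - CARD('n option)) g" "g x2 \<noteq> 0"
    and residual: "\<And>J. J \<subseteq> V \<Longrightarrow> infeasible J \<Longrightarrow> vanishes_on f J \<and> vanishes_on g J"
  shows "zero_locus f = zero_locus g"
proof -
  let ?k = "card V - CARD('n option)"
  have zero: "h x = 0" if h: "homogeneous_poly ?k h" "vanishes_on h {}" for h x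
  proof (cases "x = 0")
    case True
    define e :: "complex ^ 'n option" where "e = axis None 1"
    have "e \<noteq> 0" by (simp add: e_def axis_eq_0_iff)
    then have "h e = 0" using h(2) by (simp add: vanishes_on_def)
    moreover have "x = 0 *s e" using True by simp
    ultimately show ?thesis using homogeneous_poly_homogeneous[OF h(1), of 0 e] by simp
  qed (use h in \<open>simp add: vanishes_on_def\<close>)
  have nz: "h = (\<lambda>x. 0)"
    if h: "homogeneous_poly ?k h" "\<And>J. J \<subseteq> V \<Longrightarrow> infeasible J \<Longrightarrow> vanishes_on h J"
      and I: "I \<subseteq> V" "card I = CARD('n)" "\<not> infeasible I" "vanishes_on h I" for h I
    using zero[OF h(1) zero_if_vanishes_on_points[OF h(1)]] vanishes_on_all_vertices[OF h I] by blast
  \<comment> \<open>If the polytope had no vertices, all points of the arrangement would be residual, and \<open>f\<close> would be zero.\<close>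
  have "\<exists>I. I \<subseteq> V \<and> card I = CARD('n) \<and> \<not> infeasible I"
    using zero[OF f(1) zero_if_vanishes_on_points[OF f(1)]] residual f(2) by blast
  then obtain I where I: "I \<subseteq> V" "card I = CARD('n)" "\<not> infeasible I" by blast
  obtain y where y: "y \<in> positive_cone" "\<forall>v\<in>I. ell_hom v y = 0" "y \<noteq> 0"
    using I(3) by (auto simp: infeasible_def)
  define p where "p = complexify y"
  have p: "p \<noteq> 0" "\<And>v. v \<in> I \<Longrightarrow> ell_hom v p = 0"
    using y by (auto simp: p_def complexify_eq_0_iff ell_hom_complexify)
  have finI: "finite I" using I finV finite_subset by blast
  have vertex: "vanishes_on h I" if h: "homogeneous_poly ?k h" "h p = 0" for h
    unfolding vanishes_on_def
  proof (intro allI impI)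
    fix x :: "complex ^ 'n option" assume x: "x \<noteq> 0" "\<forall>v\<in>I. ell_hom v x = 0"
    have "V - I \<noteq> {}" using I cardV finI by (metis card_mono finV Diff_eq_empty_iff not_le)
    then obtain k where k: "k \<in> V - I" by blast
    have kp: "ell_hom k p \<noteq> 0"
      using nonzero_off_vertex[OF I(1,2) _ y(3) k] y(2) by (simp add: p_def ell_hom_complexify)
    define c where "c = ell_hom k x / ell_hom k p"
    have "x - c *s p = 0"
      using I finI k kp x(2) p(2)
      by (intro zero_if_many_zeros[of "insert k I"]) (auto simp: ell_hom_right_linear c_def)
    then have "x = c *s p" by simp
    then show "h x = 0" using homogeneous_poly_homogeneous[OF h(1)] h(2) by simp
  qed
  have fp: "f p \<noteq> 0" using nz[OF f(1) _ I vertex[OF f(1)]] residual f(2) by auto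
  have gp: "g p \<noteq> 0" using nz[OF g(1) _ I vertex[OF g(1)]] residual g(2) by auto
  define h where "h x = g p * f x + (- f p) * g x" for x
  have h: "homogeneous_poly ?k h"
    unfolding h_def by (intro homogeneous_poly_add homogeneous_poly_scale f(1) g(1))
  have "h = (\<lambda>x. 0)"
  proof (rule nz[OF h _ I vertex[OF h]])
    show "vanishes_on h J" if "J \<subseteq> V" "infeasible J" for J
      using residual[OF that] by (simp add: vanishes_on_def h_def)
  qed (simp add: h_def)
  then have "g p * f x = f p * g x" for x
    by (simp add: h_def fun_eq_iff)
  then have "f x = 0 \<longleftrightarrow> g x = 0" for x using fp gp by (metis mult_eq_0_iff)
  then show ?thesis by (auto simp: zero_locus_def)
qed

end

section \<open>The adjoint polynomial as the adjoint hypersurface\<close>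

lemma homogeneous_poly_warren_adjoint:
  fixes P :: "(real ^ 'n) set"
  assumes "vertex_triangulation P \<T>" "finite (vertices P)"
  shows "homogeneous_poly (card (vertices P) - CARD('n option)) (warren_adjoint_hom P \<T>)"
proof -
  have "homogeneous_poly (card (vertices P) - CARD('n option)) (\<lambda>x. \<Prod>v\<in>vertices P - vertices \<sigma>. ell_hom v x)"
    if "\<sigma> \<in> \<T>" for \<sigma>
  proof -
    have \<sigma>: "int CARD('n) simplex \<sigma>" "vertices \<sigma> \<subseteq> vertices P"
      using assms(1) that by (auto simp: vertex_triangulation_def)
    then have "card (vertices P - vertices \<sigma>) = card (vertices P) - CARD('n option)"
      using simplex_vertices[OF \<sigma>(1)] by (simp add: card_Diff_subset card_UNIV_option)
    then show ?thesis
      using homogeneous_poly_prod_ell_hom[of "vertices P - vertices \<sigma>"] assms(2) by simp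
  qed
  then show ?thesis
    unfolding warren_adjoint_hom_def[abs_def] by (intro homogeneous_poly_sum homogeneous_poly_scale)
qed

text \<open>
  The vector \<open>axis None 1\<close> is the origin of affine space, where every \<open>\<ell>\<^sub>v\<close> is one.
\<close>

lemma warren_adjoint_nonzero:
  fixes P :: "(real ^ 'n) set"
  assumes "vertex_triangulation P \<T>" "P \<noteq> {}"
  shows "warren_adjoint_hom P \<T> (axis None 1) \<noteq> 0"
proof -
  have "ell_hom v (axis None 1 :: complex ^ 'n option) = 1" for v :: "real ^ 'n"
    by (simp add: ell_hom_def axis_def)
  then have "warren_adjoint_hom P \<T> (axis None 1) = of_real (\<Sum>\<sigma>\<in>\<T>. measure lebesgue \<sigma>)"
    by (simp add: warren_adjoint_hom_def)
  moreover have "0 < (\<Sum>\<sigma>\<in>\<T>. measure lebesgue \<sigma>)"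
    using assms by (intro sum_pos simplex_measure_pos) (auto simp: vertex_triangulation_def triangulation_def)
  ultimately show ?thesis by (metis less_irrefl of_real_eq_0_iff)
qed

theorem proposition1p7:
  fixes P :: "(real ^ 'n) set" and \<T> :: "(real ^ 'n) set set"
  assumes "polytope P" and "aff_dim P = int CARD('n)"
    and "vertex_triangulation P \<T>"
  shows "(\<forall>L \<in> residual_arrangement (dual_cone P). L \<subseteq> zero_locus (warren_adjoint_hom P \<T>)) \<and>
         (simple_arrangement (facet_arrangement (dual_cone P)) \<longrightarrow>
            is_adjoint_hypersurface (dual_cone P) (zero_locus (warren_adjoint_hom P \<T>)))"
proof -
  let ?A = "warren_adjoint_hom P \<T>" and ?C = "dual_cone P"
  have fin: "finite (vertices P)"
    unfolding vertices_def using assms(1) by (simp add: finite_polyhedron_extreme_points polytope_imp_polyhedron)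
  have "convex P" using assms(1) by (rule polytope_imp_convex)
  have "P \<noteq> {}" using assms(2) by auto
  have vanish: "\<forall>L \<in> residual_arrangement ?C. L \<subseteq> zero_locus ?A"
  proof (intro ballI subsetI)
    fix L x assume L: "L \<in> residual_arrangement ?C" "x \<in> L"
    note r = residual_arrangement_point[OF assms(1) fin L]
    show "x \<in> zero_locus ?A"
      using warren_adjoint_vanishes[OF assms(3) \<open>convex P\<close> fin r] r(1) by (simp add: zero_locus_def)
  qed
  have "is_adjoint_hypersurface ?C (zero_locus ?A)" if simple: "simple_arrangement (facet_arrangement ?C)"
  proof -
    let ?V = "vertices P"
    note arr = facet_arrangement_dual_cone[OF assms(1) fin] and inj = vertex_hyperplanes_distinct[OF assms(1) fin]
    have facets: "card {F. F facet_of ?C} = card ?V"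
      unfolding arr(2) using inj(1) by (rule card_image)
    obtain \<sigma> where \<sigma>: "\<sigma> \<in> \<T>" using assms(3) \<open>P \<noteq> {}\<close> by (auto simp: vertex_triangulation_def)
    have s: "int CARD('n) simplex \<sigma>" "vertices \<sigma> \<subseteq> ?V" using assms(3) \<sigma> by (auto simp: vertex_triangulation_def)
    interpret general_position ?V
    proof
      show "finite ?V" by (rule fin)
      show "CARD('n) < card ?V"
        using card_mono[OF fin s(2)] simplex_vertices(2)[OF s(1)] by simp
      fix x :: "complex ^ 'n option" assume "x \<noteq> 0"
      have "{H \<in> facet_arrangement ?C. x \<in> H} = polar_hyperplane ` {v \<in> ?V. ell_hom v x = 0}"
        using \<open>x \<noteq> 0\<close> by (auto simp: arr(1) polar_hyperplane_def zero_locus_def)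
      moreover have "inj_on polar_hyperplane {v \<in> ?V. ell_hom v x = 0}"
        using inj(2) by (rule inj_on_subset) auto
      ultimately have "card {v \<in> ?V. ell_hom v x = 0} = card {H \<in> facet_arrangement ?C. x \<in> H}"
        by (simp add: card_image)
      also have "\<dots> \<le> CARD('n option) - 1"
        using simple \<open>x \<noteq> 0\<close> by (simp add: simple_arrangement_def)
      finally show "card {v \<in> ?V. ell_hom v x = 0} \<le> CARD('n)" by (simp add: card_UNIV_option)
    qed
    have vanishes: "vanishes_on f J"
      if "\<forall>L \<in> residual_arrangement ?C. L \<subseteq> zero_locus f" "J \<subseteq> ?V" "infeasible J" for f J
    proof -
      have "\<Inter>(polar_hyperplane ` J) \<in> residual_arrangement ?C"
        by (rule residual_arrangementI[OF assms(1) fin that(2)])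
           (use that(3) in \<open>auto simp: infeasible_def positive_cone_def dual_cone_def\<close>)
      with that(1) have sub: "\<Inter>(polar_hyperplane ` J) \<subseteq> zero_locus f" by blast
      show ?thesis
        unfolding vanishes_on_def
      proof (intro allI impI)
        fix x :: "complex ^ 'n option" assume "x \<noteq> 0" "\<forall>v\<in>J. ell_hom v x = 0"
        then have "x \<in> \<Inter>(polar_hyperplane ` J)"
          by (simp add: polar_hyperplane_def zero_locus_def)
        then show "f x = 0" using sub by (auto simp: zero_locus_def)
      qed
    qed
    have A: "homogeneous_poly (card ?V - CARD('n option)) ?A"
      by (rule homogeneous_poly_warren_adjoint[OF assms(3) fin])
    note A0 = warren_adjoint_nonzero[OF assms(3) \<open>P \<noteq> {}\<close>]
    have "X = zero_locus ?A"
      if X: "hypersurface (card ?V - CARD('n option)) X" "\<forall>L \<in> residual_arrangement ?C. L \<subseteq> X" for X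
    proof -
      obtain f x where f: "homogeneous_poly (card ?V - CARD('n option)) f" "f x \<noteq> 0" "X = zero_locus f"
        using X(1) by (auto simp: hypersurface_def)
      show ?thesis
        unfolding f(3)
      proof (rule adjoint_form_unique[OF f(1,2) A A0])
        fix J assume J: "J \<subseteq> ?V" "infeasible J"
        show "vanishes_on f J \<and> vanishes_on ?A J"
          using vanishes[OF X(2)[unfolded f(3)] J] vanishes[OF vanish J] by blast
      qed
    qed
    then show ?thesis
      unfolding is_adjoint_hypersurface_def Let_def facets
      using vanish A A0 by (auto simp: hypersurface_def)
  qed
  with vanish show ?thesis by blast
qed

end
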